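(* For all probabilistic regular expressions $e,f\in\mathsf{Exp}$ over a finite alphabet $A$: if $\llbracket e\rrbracket=\llbracket f\rrbracket$, then $e\equiv f$.
   Context: Fix a finite alphabet $A$. Probabilistic regular expressions are generated by the grammar $e,f ::= \mathsf{0}\mid \mathsf{1}\mid a\ (a\in A)\mid e\oplus_p f\mid e\,;f\mid e^{[p]}$ with $p\in[0,1]$; $\mathsf{Exp}$ denotes the set of all of them. For a set $X$, $\mathcal{D}X$ is the set of finitely supported subdistributions on $X$, i.e. maps $\nu:X\to[0,1]$ with finite support and $\sum_x\nu(x)\le 1$; $\delta_x$ is the Dirac subdistribution at $x$ and $0$ is the subdistribution with empty support. Write $\checkmark$ for the unique element of the one-point set and $FX=\{\checkmark\}+A\times X$. The Antimirov derivative $\partial:\mathsf{Exp}\to\mathcal{D}F\mathsf{Exp}$ is defined by: $\partial(\mathsf{0})=0$, $\partial(\mathsf{1})=\delta_\checkmark$, $\partial(a)=\delta_{(a,\mathsf{1})}$, $\partial(e\oplus_p f)=p\,\partial(e)+(1-p)\,\partial(f)$; $\partial(e;f)(\checkmark)=\partial(e)(\checkmark)\partial(f)(\checkmark)$ and $\partial(e;f)(a,g)=\partial(e)(\checkmark)\partial(f)(a,g)+\sum_{e':\ e';f=g}\partial(e)(a,e')$; for loops, if $p=1$ and $\partial(e)(\checkmark)=1$ then $\partial(e^{[p]})=0$, and otherwise $\partial(e^{[p]})(\checkmark)=\frac{1-p}{1-p\partial(e)(\checkmark)}$, $\partial(e^{[p]})(a,e';e^{[p]})=\frac{p\,\partial(e)(a,e')}{1-p\partial(e)(\checkmark)}$,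 and $\partial(e^{[p]})$ is $0$ on all other elements. The language semantics $\llbracket e\rrbracket:A^*\to[0,1]$ is defined by $\llbracket e\rrbracket(\varepsilon)=\partial(e)(\checkmark)$ and $\llbracket e\rrbracket(av)=\sum_{e'\in\mathsf{Exp}}\partial(e)(a,e')\,\llbracket e'\rrbracket(v)$. The termination function $E:\mathsf{Exp}\to[0,1]$: $E(\mathsf{1})=1$, $E(\mathsf{0})=E(a)=0$, $E(e\oplus_p f)=pE(e)+(1-p)E(f)$, $E(e;f)=E(e)E(f)$, $E(e^{[p]})=0$ if $E(e)=1$ and $p=1$, and $E(e^{[p]})=\frac{1-p}{1-pE(e)}$ otherwise. Write $\bar p=1-p$. The relation $\equiv$ is the least congruence on $\mathsf{Exp}$ (w.r.t. all syntactic operations) containing, for all $e,f,g\in\mathsf{Exp}$, $p,q\in[0,1]$ (instances involving a division only when the denominator is nonzero): (C1) $e\equiv e\oplus_p e$; (C2) $e\equiv e\oplus_1 f$; (C3) $e\oplus_p f\equiv f\oplus_{\bar p} e$; (C4) $(e\oplus_p f)\oplus_q g\equiv e\oplus_{pq}(f\oplus_{\frac{\bar p q}{1-pq}} g)$; (D1) $(e\oplus_p f);g\equiv e;g\oplus_p f;g$; (D2) $e;(f\oplus_p g)\equiv e;f\oplus_p e;g$; (0S) $\mathsf{0};e\equiv\mathsf{0}$; (S0) $e;\mathsf{0}\equiv \mathsf{0}$; (1S) $\mathsf{1};e\equiv e$; (S1) $e;\mathsf{1}\equiv e$; (S) $e;(f;g)\equiv(e;f);g$; (Unroll) $e;e^{[p]}\oplus_p\mathsf{1}\equiv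 e^{[p]}$; (Tight) $(e\oplus_p\mathsf{1})^{[q]};\mathsf{1}\equiv e^{[\frac{pq}{1-\bar p q}]}$; (Div) $\mathsf{1}^{[1]}\equiv\mathsf{0}$; and closed under the rule (Unique): if $g\equiv e;g\oplus_p f$ and $E(e)=0$ then $g\equiv e^{[p]};f$. *)

theory Defs
  imports Complex_Main
begin

typedef prob = "{0..1::real}"
  morphisms real_of_prob prob_of_real
  by (rule exI[of _ 0]) simp

declare [[coercion real_of_prob]]

(* prob_of_real is unspecified outside [0,1]; the lemmas prob_of_real_* below show that
   it is applied only to elements of [0,1] in the axioms of pexp_equiv. *)

datatype 'a pexp =
    Zero                               (\<open>\<zero>\<close>)
  | One                                (\<open>\<one>\<close>)
  | Atom 'a
  | Choice "'a pexp" prob "'a pexp"    (\<open>_ \<oplus>[_] _\<close> [66, 0, 66] 65)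
  | Seq "'a pexp" "'a pexp"            (\<open>_ \<odot> _\<close> [71, 71] 70)
  | Loop "'a pexp" prob                (\<open>_ \<^bsup>[_]\<^esup>\<close> [90, 0] 90)

type_synonym ('a, 'x) F = "unit + 'a \<times> 'x"

abbreviation tick :: "('a, 'x) F"  (\<open>\<checkmark>\<close>)
  where "\<checkmark> \<equiv> Inl ()"

definition subdist :: "('x \<Rightarrow> real) set" where
  "subdist = {\<nu>. range \<nu> \<subseteq> {0..1} \<and> finite {x. \<nu> x \<noteq> 0} \<and> (\<Sum>x | \<nu> x \<noteq> 0. \<nu> x) \<le> 1}"

definition dirac :: "'x \<Rightarrow> 'x \<Rightarrow> real"  (\<open>\<delta>\<close>)
  where "\<delta> x = (\<lambda>y. if y = x then 1 else 0)"

(* The Antimirov derivative. That its values are finitely supported subdistributions is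
   lemma antimirov_subdist. *)
primrec antimirov :: "'a pexp \<Rightarrow> ('a, 'a pexp) F \<Rightarrow> real"  (\<open>\<partial>\<close>) where
  "\<partial> \<zero> = (\<lambda>_. 0)"
| "\<partial> \<one> = \<delta> \<checkmark>"
| "\<partial> (Atom a) = \<delta> (Inr (a, \<one>))"
| "\<partial> (e \<oplus>[p] f) = (\<lambda>x. p * \<partial> e x + (1 - p) * \<partial> f x)"
| "\<partial> (e \<odot> f) = (\<lambda>x. case x of
       Inl _ \<Rightarrow> \<partial> e \<checkmark> * \<partial> f \<checkmark>
     | Inr (a, g) \<Rightarrow> \<partial> e \<checkmark> * \<partial> f (Inr (a, g)) + (\<Sum>e' | e' \<odot> f = g. \<partial> e (Inr (a, e'))))"
| "\<partial> (e \<^bsup>[p]\<^esup>) = (if real_of_prob p = 1 \<and> \<partial> e \<checkmark> = 1 then (\<lambda>_. 0) else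
     (\<lambda>x. case x of
       Inl _ \<Rightarrow> (1 - p) / (1 - p * \<partial> e \<checkmark>)
     | Inr (a, g) \<Rightarrow> (case g of
           e' \<odot> h \<Rightarrow> if h = e \<^bsup>[p]\<^esup> then p * \<partial> e (Inr (a, e')) / (1 - p * \<partial> e \<checkmark>) else 0
         | _ \<Rightarrow> 0)))"

(* The sum over all expressions is taken over the finite set where the derivative is nonzero. *)
primrec prob_lang :: "'a pexp \<Rightarrow> 'a list \<Rightarrow> real"  (\<open>\<lbrakk>_\<rbrakk>\<close>) where
  "\<lbrakk>e\<rbrakk> [] = \<partial> e \<checkmark>"
| "\<lbrakk>e\<rbrakk> (a # v) = (\<Sum>e' | \<partial> e (Inr (a, e')) \<noteq> 0. \<partial> e (Inr (a, e')) * \<lbrakk>e'\<rbrakk> v)"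

primrec termE :: "'a pexp \<Rightarrow> real" where
  "termE \<zero> = 0"
| "termE \<one> = 1"
| "termE (Atom a) = 0"
| "termE (e \<oplus>[p] f) = p * termE e + (1 - p) * termE f"
| "termE (e \<odot> f) = termE e * termE f"
| "termE (e \<^bsup>[p]\<^esup>) = (if termE e = 1 \<and> real_of_prob p = 1 then 0 else (1 - p) / (1 - p * termE e))"

inductive pexp_equiv :: "'a pexp \<Rightarrow> 'a pexp \<Rightarrow> bool"  (infix \<open>\<simeq>\<close> 50) where
  Refl:   "e \<simeq> e"
| Sym:    "e \<simeq> f \<Longrightarrow> f \<simeq> e"
| Trans:  "e \<simeq> f \<Longrightarrow> f \<simeq> g \<Longrightarrow> e \<simeq> g"
| Cong_choice: "e \<simeq> e' \<Longrightarrow> f \<simeq> f' \<Longrightarrow> e \<oplus>[p] f \<simeq> e' \<oplus>[p] f'"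
| Cong_seq:    "e \<simeq> e' \<Longrightarrow> f \<simeq> f' \<Longrightarrow> e \<odot> f \<simeq> e' \<odot> f'"
| Cong_loop:   "e \<simeq> e' \<Longrightarrow> e \<^bsup>[p]\<^esup> \<simeq> e' \<^bsup>[p]\<^esup>"
| C1:     "e \<simeq> e \<oplus>[p] e"
| C2:     "e \<simeq> e \<oplus>[prob_of_real 1] f"
| C3:     "e \<oplus>[p] f \<simeq> f \<oplus>[prob_of_real (1 - p)] e"
| C4:     "1 - p * q \<noteq> 0 \<Longrightarrow>
             (e \<oplus>[p] f) \<oplus>[q] g
               \<simeq> e \<oplus>[prob_of_real (p * q)] (f \<oplus>[prob_of_real ((1 - p) * q / (1 - p * q))] g)"
| D1:     "(e \<oplus>[p] f) \<odot> g \<simeq> e \<odot> g \<oplus>[p] f \<odot> g"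
| D2:     "e \<odot> (f \<oplus>[p] g) \<simeq> e \<odot> f \<oplus>[p] e \<odot> g"
| S0l:    "\<zero> \<odot> e \<simeq> \<zero>"
| S0r:    "e \<odot> \<zero> \<simeq> \<zero>"
| S1l:    "\<one> \<odot> e \<simeq> e"
| S1r:    "e \<odot> \<one> \<simeq> e"
| SAssoc: "e \<odot> (f \<odot> g) \<simeq> (e \<odot> f) \<odot> g"
| Unroll: "e \<odot> e \<^bsup>[p]\<^esup> \<oplus>[p] \<one> \<simeq> e \<^bsup>[p]\<^esup>"
| Tight:  "1 - (1 - p) * q \<noteq> 0 \<Longrightarrow>
             (e \<oplus>[p] \<one>) \<^bsup>[q]\<^esup> \<odot> \<one> \<simeq> e \<^bsup>[prob_of_real (p * q / (1 - (1 - p) * q))]\<^esup>"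
| Div:    "\<one> \<^bsup>[prob_of_real 1]\<^esup> \<simeq> \<zero>"
| Unique: "g \<simeq> e \<odot> g \<oplus>[p] f \<Longrightarrow> termE e = 0 \<Longrightarrow> g \<simeq> e \<^bsup>[p]\<^esup> \<odot> f"

lemma real_of_prob_bounds: "0 \<le> real_of_prob p" "real_of_prob p \<le> 1"
  using real_of_prob[of p] by simp_all

lemma prob_of_real_one: "real_of_prob (prob_of_real 1) = 1"
  by (simp add: prob_of_real_inverse)

lemma prob_of_real_compl: "real_of_prob (prob_of_real (1 - p)) = 1 - p" for p :: prob
  by (simp add: prob_of_real_inverse real_of_prob_bounds)

lemma prob_of_real_mult: "real_of_prob (prob_of_real (p * q)) = p * q" for p q :: prob
  by (simp add: prob_of_real_inverse real_of_prob_bounds mult_le_one)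

lemma prob_of_real_C4:
  fixes p q :: prob
  assumes "1 - p * q \<noteq> 0"
  shows "real_of_prob (prob_of_real ((1 - p) * q / (1 - p * q))) = (1 - p) * q / (1 - p * q)"
proof -
  have "real_of_prob p * q \<le> 1" by (simp add: real_of_prob_bounds mult_le_one)
  with assms have "1 - real_of_prob p * q > 0" by linarith
  then have "(1 - p) * q / (1 - p * q) \<in> {0..1}"
    using real_of_prob_bounds[of p] real_of_prob_bounds[of q]
    by (simp add: divide_le_eq algebra_simps mult_left_le_one_le)
  then show ?thesis by (rule prob_of_real_inverse)
qed

lemma prob_of_real_Tight:
  fixes p q :: prob
  assumes "1 - (1 - p) * q \<noteq> 0"
  shows "real_of_prob (prob_of_real (p * q / (1 - (1 - p) * q))) = p * q / (1 - (1 - p) * q)"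
proof -
  have "(1 - real_of_prob p) * q \<le> 1" by (simp add: real_of_prob_bounds mult_le_one)
  with assms have "1 - (1 - real_of_prob p) * q > 0" by linarith
  then have "p * q / (1 - (1 - p) * q) \<in> {0..1}"
    using real_of_prob_bounds[of p] real_of_prob_bounds[of q]
    by (simp add: divide_le_eq algebra_simps)
  then show ?thesis by (rule prob_of_real_inverse)
qed

lemma subdistI:
  assumes "finite S" "\<And>x. x \<notin> S \<Longrightarrow> \<nu> x = 0" "\<And>x. 0 \<le> \<nu> x" "sum \<nu> S \<le> 1"
  shows "\<nu> \<in> subdist"
proof -
  have supp: "{x. \<nu> x \<noteq> 0} \<subseteq> S" using assms(2) by blast
  have "\<nu> x \<le> 1" for x
  proof (cases "x \<in> S")
    case True
    then show ?thesis using member_le_sum[of x S \<nu>] assms by fastforce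
  qed (simp add: assms(2))
  moreover have "(\<Sum>x | \<nu> x \<noteq> 0. \<nu> x) = sum \<nu> S"
    by (rule sum.mono_neutral_left) (use assms supp in auto)
  ultimately show ?thesis
    using assms supp by (auto simp: subdist_def intro: finite_subset)
qed

lemma subdist_bounds:
  assumes "\<nu> \<in> subdist"
  shows "0 \<le> \<nu> x" "\<nu> x \<le> 1"
proof -
  have "\<nu> x \<in> range \<nu>" by simp
  also have "range \<nu> \<subseteq> {0..1}" using assms by (simp add: subdist_def)
  finally show "0 \<le> \<nu> x" "\<nu> x \<le> 1" by simp_all
qed

lemma subdistD:
  assumes "\<nu> \<in> subdist"
  shows "\<exists>S. finite S \<and> t \<in> S \<and> (\<forall>x. x \<notin> S \<longrightarrow> \<nu> x = 0) \<and> (\<forall>x. 0 \<le> \<nu> x) \<and> sum \<nu> S \<le> 1"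
proof (intro exI conjI)
  let ?S = "insert t {x. \<nu> x \<noteq> 0}"
  have fin: "finite {x. \<nu> x \<noteq> 0}" using assms by (simp add: subdist_def)
  then show "finite ?S" by simp
  have "sum \<nu> ?S = (\<Sum>x | \<nu> x \<noteq> 0. \<nu> x)"
    by (rule sum.mono_neutral_right) (use fin in auto)
  then show "sum \<nu> ?S \<le> 1" using assms by (simp add: subdist_def)
  show "\<forall>x. 0 \<le> \<nu> x"
    using subdist_bounds[OF assms] by blast
qed auto

(* The part of an element of D(F Exp) outside the tick, moved along e' to e';f. *)
definition push :: "'a pexp \<Rightarrow> (('a, 'a pexp) F \<Rightarrow> real) \<Rightarrow> ('a, 'a pexp) F \<Rightarrow> real" where
  "push f \<nu> x = (case x of Inl _ \<Rightarrow> 0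
     | Inr (a, g) \<Rightarrow> (\<Sum>e' | e' \<odot> f = g. \<nu> (Inr (a, e'))))"

lemma push_simps:
  "push f \<nu> (Inl u) = 0"
  "push f \<nu> (Inr (a, e' \<odot> f)) = \<nu> (Inr (a, e'))"
  by (simp_all add: push_def)

lemma push_eq_0: "(\<And>e'. g \<noteq> e' \<odot> f) \<Longrightarrow> push f \<nu> (Inr (a, g)) = 0"
  by (auto simp: push_def intro!: sum.neutral)

lemma push_mass:
  assumes "\<nu> \<in> subdist"
  shows "\<exists>T. finite T \<and> \<checkmark> \<notin> T \<and> (\<forall>x. x \<notin> T \<longrightarrow> push f \<nu> x = 0)
    \<and> (\<forall>x. 0 \<le> push f \<nu> x) \<and> sum (push f \<nu>) T \<le> 1 - \<nu> \<checkmark>"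
proof -
  obtain S where S: "finite S" "\<checkmark> \<in> S" "\<And>x. x \<notin> S \<Longrightarrow> \<nu> x = 0" "\<And>x. 0 \<le> \<nu> x" "sum \<nu> S \<le> 1"
    using subdistD[OF assms] by blast
  let ?h = "map_sum id (map_prod id (\<lambda>e'. e' \<odot> f))"
  let ?T = "?h ` (S - {\<checkmark>})"
  have T1: "finite ?T" using S by simp
  have nt: "?h y \<noteq> \<checkmark>" if "y \<noteq> \<checkmark>" for y :: "('a, 'a pexp) F"
    using that by (cases y) auto
  have T2: "\<checkmark> \<notin> ?T"
    using nt by fastforce
  have h: "push f \<nu> (?h y) = \<nu> y" if "y \<noteq> \<checkmark>" for y
    using that by (cases y) (auto simp: push_simps)
  have T3: "push f \<nu> x = 0" if x: "x \<notin> ?T" for x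
  proof (cases x)
    case (Inr b)
    obtain a g where b: "b = (a, g)" by (cases b)
    show ?thesis
    proof (cases "\<exists>e'. g = e' \<odot> f")
      case True
      then obtain e' where g: "g = e' \<odot> f" by blast
      have "Inr (a, e') \<notin> S"
      proof
        assume "Inr (a, e') \<in> S"
        then have "?h (Inr (a, e')) \<in> ?T" by blast
        with x Inr b g show False by simp
      qed
      then show ?thesis using S Inr b g by (simp add: push_simps)
    next
      case False
      then have "push f \<nu> (Inr (a, g)) = 0" by (intro push_eq_0) blast
      then show ?thesis using Inr b by simp
    qed
  qed (simp add: push_simps)
  have T4: "0 \<le> push f \<nu> x" for x
    unfolding push_def by (simp add: S(4) sum_nonneg split: sum.split prod.split)
  have inj: "inj_on ?h (S - {\<checkmark>})"
    by (auto simp: inj_on_def map_sum_def map_prod_def split: sum.splits)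
  have "sum (push f \<nu>) ?T = sum (\<lambda>y. push f \<nu> (?h y)) (S - {\<checkmark>})"
    by (simp add: sum.reindex[OF inj])
  also have "\<dots> = sum \<nu> (S - {\<checkmark>})" by (rule sum.cong) (simp_all add: h)
  also have "\<dots> = sum \<nu> S - \<nu> \<checkmark>" using S by (simp add: sum_diff1)
  finally have "sum (push f \<nu>) ?T \<le> 1 - \<nu> \<checkmark>" using S by simp
  with T1 T2 T3 T4 show ?thesis by blast
qed

lemma antimirov_Seq_push: "\<partial> (e \<odot> f) x = \<partial> e \<checkmark> * \<partial> f x + push f (\<partial> e) x"
  by (auto simp: push_def split: sum.split)

lemma antimirov_Loop_push:
  assumes "\<not> (real_of_prob p = 1 \<and> \<partial> e \<checkmark> = 1)"
  shows "\<partial> (e \<^bsup>[p]\<^esup>) x =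
    ((1 - p) * \<delta> \<checkmark> x + p * push (e \<^bsup>[p]\<^esup>) (\<partial> e) x) / (1 - p * \<partial> e \<checkmark>)"
proof (cases x)
  case (Inl u)
  then show ?thesis using assms by (simp add: push_simps dirac_def)
next
  case (Inr b)
  obtain a g where b: "b = (a, g)" by (cases b)
  show ?thesis
  proof (cases "\<exists>e'. g = e' \<odot> e \<^bsup>[p]\<^esup>")
    case True
    then show ?thesis using assms Inr b by (auto simp: push_simps dirac_def)
  next
    case False
    then have "push (e \<^bsup>[p]\<^esup>) (\<partial> e) (Inr (a, g)) = 0" by (intro push_eq_0) blast
    then show ?thesis using assms Inr b False by (auto simp: dirac_def split: pexp.split)
  qed
qed

lemma antimirov_subdist: "\<partial> e \<in> subdist"
proof (induction e)
  case Zero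
  show ?case by (rule subdistI[of "{}"]) auto
next
  case One
  show ?case by (rule subdistI[of "{\<checkmark>}"]) (auto simp: dirac_def)
next
  case (Atom a)
  show ?case by (rule subdistI[of "{Inr (a, \<one>)}"]) (auto simp: dirac_def)
next
  case (Choice e p f)
  obtain S where S: "finite S" "\<checkmark> \<in> S" "\<And>x. x \<notin> S \<Longrightarrow> \<partial> e x = 0"
    "\<And>x. 0 \<le> \<partial> e x" "sum (\<partial> e) S \<le> 1"
    using subdistD[OF Choice(1), of \<checkmark>] by blast
  obtain T where T: "finite T" "\<checkmark> \<in> T" "\<And>x. x \<notin> T \<Longrightarrow> \<partial> f x = 0"
    "\<And>x. 0 \<le> \<partial> f x" "sum (\<partial> f) T \<le> 1"
    using subdistD[OF Choice(2), of \<checkmark>] by blast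
  have "sum (\<partial> e) (S \<union> T) = sum (\<partial> e) S" "sum (\<partial> f) (S \<union> T) = sum (\<partial> f) T"
    by (rule sum.mono_neutral_right; use S T in auto)+
  then have "sum (\<partial> (e \<oplus>[p] f)) (S \<union> T) = p * sum (\<partial> e) S + (1 - p) * sum (\<partial> f) T"
    by (simp add: sum.distrib flip: sum_distrib_left)
  also have "\<dots> \<le> 1"
    using S T real_of_prob_bounds[of p] by (intro convex_bound_le) auto
  finally show ?case
    using S T real_of_prob_bounds[of p] by (intro subdistI[of "S \<union> T"]) auto
next
  case (Seq e f)
  obtain S where S: "finite S" "\<checkmark> \<in> S" "\<And>x. x \<notin> S \<Longrightarrow> \<partial> e x = 0"
    "\<And>x. 0 \<le> \<partial> e x" "sum (\<partial> e) S \<le> 1"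
    using subdistD[OF Seq(1), of \<checkmark>] by blast
  obtain T where T: "finite T" "\<checkmark> \<in> T" "\<And>x. x \<notin> T \<Longrightarrow> \<partial> f x = 0"
    "\<And>x. 0 \<le> \<partial> f x" "sum (\<partial> f) T \<le> 1"
    using subdistD[OF Seq(2), of \<checkmark>] by blast
  obtain U where U: "finite U" "\<checkmark> \<notin> U" "\<And>x. x \<notin> U \<Longrightarrow> push f (\<partial> e) x = 0"
    "\<And>x. 0 \<le> push f (\<partial> e) x" "sum (push f (\<partial> e)) U \<le> 1 - \<partial> e \<checkmark>"
    using push_mass[OF Seq(1), of f] by blast
  have "sum (\<partial> f) (T \<union> U) = sum (\<partial> f) T" "sum (push f (\<partial> e)) (T \<union> U) = sum (push f (\<partial> e)) U"
    by (rule sum.mono_neutral_right; use T U in auto)+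
  then have "sum (\<partial> (e \<odot> f)) (T \<union> U) = \<partial> e \<checkmark> * sum (\<partial> f) T + sum (push f (\<partial> e)) U"
    by (simp add: antimirov_Seq_push sum.distrib del: antimirov.simps flip: sum_distrib_left)
  also have "\<dots> \<le> 1"
    using mult_left_mono[OF T(5) S(4)[of \<checkmark>]] U(5) by simp
  finally show ?case
    using S T U by (intro subdistI[of "T \<union> U"]) (auto simp: antimirov_Seq_push simp del: antimirov.simps)
next
  case (Loop e p)
  show ?case
  proof (cases "real_of_prob p = 1 \<and> \<partial> e \<checkmark> = 1")
    case True
    then show ?thesis by (intro subdistI[of "{}"]) auto
  next
    case False
    let ?g = "e \<^bsup>[p]\<^esup>"
    obtain U where U: "finite U" "\<checkmark> \<notin> U" "\<And>x. x \<notin> U \<Longrightarrow> push ?g (\<partial> e) x = 0"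
      "\<And>x. 0 \<le> push ?g (\<partial> e) x" "sum (push ?g (\<partial> e)) U \<le> 1 - \<partial> e \<checkmark>"
      using push_mass[OF Loop, of ?g] by blast
    have t: "\<partial> e \<checkmark> \<le> 1" "0 \<le> \<partial> e \<checkmark>"
      using subdist_bounds[OF Loop] by auto
    have "p * \<partial> e \<checkmark> < 1"
    proof (cases "real_of_prob p = 1")
      case True
      with False t show ?thesis by simp
    next
      case False
      then have "real_of_prob p < 1" using real_of_prob_bounds[of p] by simp
      with t real_of_prob_bounds[of p] show ?thesis
        using mult_left_le[of "\<partial> e \<checkmark>" "real_of_prob p"] by linarith
    qed
    then have d: "0 < 1 - p * \<partial> e \<checkmark>" by simp
    have "sum (\<delta> \<checkmark>) (insert \<checkmark> U) = (1::real)"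
      using U by (simp add: dirac_def)
    moreover have "sum (push ?g (\<partial> e)) (insert \<checkmark> U) = sum (push ?g (\<partial> e)) U"
      using U by (simp add: push_simps)
    ultimately have "sum (\<partial> ?g) (insert \<checkmark> U)
        = ((1 - p) + p * sum (push ?g (\<partial> e)) U) / (1 - p * \<partial> e \<checkmark>)"
      by (simp add: antimirov_Loop_push[OF False] sum.distrib del: antimirov.simps sum.insert
          flip: sum_divide_distrib sum_distrib_left)
    also have "\<dots> \<le> 1"
      using mult_left_mono[OF U(5) real_of_prob_bounds(1)[of p]] d
      by (simp add: divide_le_eq algebra_simps)
    finally show ?thesis
      using U d real_of_prob_bounds[of p]
      by (intro subdistI[of "insert \<checkmark> U"])
        (auto simp: antimirov_Loop_push[OF False] dirac_def simp del: antimirov.simps)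
  qed
qed

end

theory Submission imports Defs begin

text \<open>Expressions modulo \<open>\<simeq>\<close>, formally scaled by nonnegative weights, form a semiring in which a
  convex combination is an honest sum. There, a guarded linear system whose weights balance
  has exactly one solution of prescribed height, by Gaussian elimination with the loop as the pivot
  inverse. Every expression is a component of such a system, indexed by its derivatives.

  The total mass \<open>\<mu> = \<Sum>v. \<lbrakk>e\<rbrakk> v\<close> of the derivatives balances the system obtained by dropping the
  \<open>\<zero>\<close> summands, whose solution \<open>U\<close> therefore has height \<open>\<mu>\<close>, and \<open>e = U + (1 - \<mu>) \<zero>\<close>. In this way
  language equivalent combinations of the \<open>U\<close> have equal height. The pairs of nonnegative vectors
  inducing the same language form a finitely generated cone that is closed under derivatives, so writing the
  derivatives of the generators in terms of the generators yields one linear system solved by the left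
  and by the right halves of the generators. By uniqueness the halves coincide, and hence so do
  any two language equivalent combinations.\<close>

section \<open>The semiring of weighted expressions\<close>

lemma real_of_prob_of_real: "0 \<le> r \<Longrightarrow> r \<le> 1 \<Longrightarrow> real_of_prob (prob_of_real r) = r"
  by (simp add: prob_of_real_inverse)

lemma choice_comm:
  assumes "0 < r" "0 < s"
  shows "e \<oplus>[prob_of_real (r / (r + s))] f \<simeq> f \<oplus>[prob_of_real (s / (s + r))] e"
proof -
  have "1 - r / (r + s) = s / (s + r)"
    using assms by (simp add: field_simps)
  with C3[of e "prob_of_real (r / (r + s))" f] assms show ?thesis
    by (simp add: real_of_prob_of_real)
qed

text \<open>This is \<open>C4\<close> for parameters that are ratios of positive weights. The factor
  \<open>1 - p * q\<close> becomes \<open>(s + t) / (r + s + t)\<close>, so the side condition of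
  \<open>C4\<close> holds.\<close>

lemma choice_assoc:
  assumes "0 < r" "0 < s" "0 < t"
  shows "(e \<oplus>[prob_of_real (r / (r + s))] f) \<oplus>[prob_of_real ((r + s) / (r + s + t))] g
    \<simeq> e \<oplus>[prob_of_real (r / (r + (s + t)))] (f \<oplus>[prob_of_real (s / (s + t))] g)"
proof -
  let ?p = "prob_of_real (r / (r + s))" and ?q = "prob_of_real ((r + s) / (r + s + t))"
  have p: "real_of_prob ?p = r / (r + s)" and q: "real_of_prob ?q = (r + s) / (r + s + t)"
    using assms by (simp_all add: real_of_prob_of_real)
  have pq: "?p * ?q = r / (r + (s + t))"
    unfolding p q using assms by (simp add: add.assoc)
  have "1 - r / (r + (s + t)) = (s + t) / (r + (s + t))"
    using assms by (simp add: field_simps)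
  moreover have "(1 - r / (r + s)) * ((r + s) / (r + s + t)) = s / (r + (s + t))"
    using assms by (simp add: divide_simps)
  ultimately have "(1 - ?p) * ?q / (1 - ?p * ?q) = s / (s + t)" "1 - ?p * ?q \<noteq> 0"
    unfolding pq unfolding p q using assms by (simp_all add: add.assoc)
  with C4[of ?p ?q e f g] show ?thesis
    by (simp add: pq)
qed

text \<open>This is the cone over the convex algebra of expressions modulo \<open>\<simeq>\<close>. The expression
  \<open>\<zero>\<close> with weight \<open>r > 0\<close> differs from 0 and no cancellation law is needed to embed expressions;
  all pairs of weight at most 0 represent 0.\<close>

definition wrel :: "real \<times> 'a pexp \<Rightarrow> real \<times> 'a pexp \<Rightarrow> bool" where
  "wrel x y \<longleftrightarrow> fst x \<le> 0 \<and> fst y \<le> 0 \<or> fst x = fst y \<and> snd x \<simeq> snd y"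

quotient_type 'a wexp = "real \<times> 'a pexp" / wrel
proof (rule equivpI)
  show "reflp wrel" by (auto simp: reflp_def wrel_def intro: Refl)
  show "symp wrel" by (auto simp: symp_def wrel_def intro: Sym)
  show "transp wrel" by (auto simp: transp_def wrel_def intro: Trans)
qed

lift_definition wgt :: "real \<Rightarrow> 'a pexp \<Rightarrow> 'a wexp" is Pair .

lift_definition height :: "'a wexp \<Rightarrow> real" is "\<lambda>x. max 0 (fst x)"
  by (auto simp: wrel_def)

lemma wgt_eq_iff: "wgt r e = wgt s f \<longleftrightarrow> r \<le> 0 \<and> s \<le> 0 \<or> r = s \<and> e \<simeq> f"
  by transfer (simp add: wrel_def)

lemma wexp_cases: obtains r e where "w = wgt r e" "0 \<le> r"
proof -
  obtain s e where w: "w = wgt s e"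
    by transfer (auto simp: wrel_def intro: Refl)
  have "w = wgt (max 0 s) e"
    unfolding w wgt_eq_iff by (auto simp: max_def intro: Refl)
  then show thesis using that[of "max 0 s" e] by simp
qed

instantiation wexp :: (type) semiring_1
begin

lift_definition zero_wexp :: "'a wexp" is "(0, \<zero>)" .
lift_definition one_wexp :: "'a wexp" is "(1, \<one>)" .
lift_definition plus_wexp :: "'a wexp \<Rightarrow> 'a wexp \<Rightarrow> 'a wexp" is
  "\<lambda>x y. if fst x \<le> 0 then y else if fst y \<le> 0 then x
    else (fst x + fst y, snd x \<oplus>[prob_of_real (fst x / (fst x + fst y))] snd y)"
  by (auto simp: wrel_def intro: Cong_choice)
lift_definition times_wexp :: "'a wexp \<Rightarrow> 'a wexp \<Rightarrow> 'a wexp" is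
  "\<lambda>x y. if fst x \<le> 0 \<or> fst y \<le> 0 then (0, \<zero>) else (fst x * fst y, snd x \<odot> snd y)"
  by (auto simp: wrel_def intro: Cong_seq Refl)

instance
proof
  fix a b c :: "'a wexp"
  show "a + b + c = a + (b + c)"
    by transfer (auto simp: wrel_def not_le add.assoc intro: Refl choice_assoc[unfolded add.assoc])
  show "a + b = b + a"
    by transfer (auto simp: wrel_def intro: Refl choice_comm)
  show "0 + a = a"
    by transfer (auto simp: wrel_def intro: Refl)
  show "0 * a = 0" "a * 0 = 0"
    by (transfer, auto simp: wrel_def intro: Refl)+
  show "a * b * c = a * (b * c)"
    by transfer (auto simp: wrel_def mult.assoc mult_le_0_iff intro: Refl SAssoc[THEN Sym])
  show "1 * a = a" "a * 1 = a"
    by (transfer, auto simp: wrel_def intro: Refl S1l S1r)+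
  show "(0::'a wexp) \<noteq> 1"
    by transfer (simp add: wrel_def)
  \<comment> \<open>A common factor cancels from the ratio of two weights, so both sides of a
    distributive law carry the same choice parameter and \<open>D1\<close>, \<open>D2\<close>
    apply.\<close>
  have r: "r * t / (r * t + s * t) = r / (r + s)" "t * r / (t * r + t * s) = r / (r + s)"
    if "0 < t" for r s t :: real
    using that by (simp_all flip: distrib_right distrib_left)
  show "(a + b) * c = a * c + b * c"
    by transfer (auto simp: wrel_def mult_le_0_iff distrib_right not_le r intro: Refl D1)
  show "a * (b + c) = a * b + a * c"
    by transfer (auto simp: wrel_def mult_le_0_iff distrib_left not_le r intro: Refl D2)
qed

end

text \<open>Scaling is multiplication by a weighted unit, so the semiring laws also govern scalars;
  by \<open>S1l\<close> and \<open>S1r\<close> they are central.\<close>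

definition scal :: "real \<Rightarrow> 'a wexp" where "scal r = wgt r \<one>"

abbreviation emb :: "'a pexp \<Rightarrow> 'a wexp" where "emb \<equiv> wgt 1"

lemma emb_eq_iff: "emb e = emb f \<longleftrightarrow> e \<simeq> f"
  by (simp add: wgt_eq_iff)

lemma height_wgt: "height (wgt r e) = max 0 r"
  by transfer simp

lemma height_nonneg [simp]: "0 \<le> height w"
  by transfer simp

lemma height_zero [simp]: "height 0 = 0" and height_one [simp]: "height 1 = 1"
  by (transfer, simp)+

lemma height_emb [simp]: "height (emb e) = 1"
  by (simp add: height_wgt)

lemma height_scal [simp]: "0 \<le> r \<Longrightarrow> height (scal r) = r"
  by (simp add: scal_def height_wgt)

lemma height_add [simp]: "height (v + w) = height v + height w"
  by transfer auto

lemma height_mult [simp]: "height (v * w) = height v * height w"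
  by transfer (auto simp: max_def mult_le_0_iff)

lemma height_sum [simp]: "height (sum g S) = (\<Sum>x\<in>S. height (g x))"
  by (induction S rule: infinite_finite_induct) auto

lemma height_eq_0_iff [simp]: "height w = 0 \<longleftrightarrow> w = 0"
  by transfer (auto simp: wrel_def max_def intro: Refl)

lemma scal_0 [simp]: "scal 0 = 0" and scal_1 [simp]: "scal 1 = 1"
  unfolding scal_def by (transfer, simp add: wrel_def Refl)+

text \<open>For positive weights the sum on the right is a choice between two copies of
  \<open>\<one>\<close>, which idempotence \<open>C1\<close> collapses.\<close>

lemma scal_add: "0 \<le> r \<Longrightarrow> 0 \<le> s \<Longrightarrow> scal (r + s) = scal r + scal s"
  unfolding scal_def by transfer (auto simp: wrel_def intro: Refl C1)

lemma scal_mult: "0 \<le> r \<Longrightarrow> scal (r * s) = scal r * scal s"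
  unfolding scal_def
  by transfer (auto simp: wrel_def zero_less_mult_iff mult_le_0_iff intro: Refl S1l[THEN Sym])

lemma scal_sum: "(\<And>x. x \<in> S \<Longrightarrow> 0 \<le> r x) \<Longrightarrow> scal (sum r S) = (\<Sum>x\<in>S. scal (r x))"
  by (induction S rule: infinite_finite_induct) (simp_all add: scal_add sum_nonneg)

lemma scal_commute: "w * scal r = scal r * w"
  unfolding scal_def
  by transfer (auto simp: wrel_def mult.commute intro: Refl Trans[OF S1r S1l[THEN Sym]])

lemma scal_left_commute: "v * (scal r * w) = scal r * (v * w)"
  by (simp add: scal_commute flip: mult.assoc)

lemma scal_cancel: "0 < r \<Longrightarrow> scal r * v = scal r * w \<longleftrightarrow> v = w"
proof
  assume r: "0 < r" and "scal r * v = scal r * w"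
  then have "scal (1 / r) * (scal r * v) = scal (1 / r) * (scal r * w)" by simp
  with r show "v = w" by (simp flip: mult.assoc scal_mult)
qed simp

lemma wgt_eq_scal_emb: "0 \<le> r \<Longrightarrow> wgt r e = scal r * emb e"
  unfolding scal_def by transfer (auto simp: wrel_def intro: S1l[THEN Sym])

lemma wexp_eq_scal_emb: obtains e where "w = scal (height w) * emb e"
  by (metis wexp_cases wgt_eq_scal_emb height_wgt max_absorb2)

lemma emb_One [simp]: "emb \<one> = 1"
  by transfer (simp add: wrel_def Refl)

lemma emb_Seq: "emb (e \<odot> f) = emb e * emb f"
  by transfer (simp add: wrel_def Refl)

lemma wgt_add: "wgt r e + wgt s f = (if r \<le> 0 then wgt s f else if s \<le> 0 then wgt r e
    else wgt (r + s) (e \<oplus>[prob_of_real (r / (r + s))] f))"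
  by transfer (auto simp: wrel_def intro: Refl)

lemma emb_Choice: "emb (e \<oplus>[p] f) = scal p * emb e + scal (1 - p) * emb f"
proof -
  \<comment> \<open>At the boundary weights 0 and 1 the semiring sum drops a summand instead of
    forming a choice, so these cases need \<open>C2\<close>, and for weight 0 also
    \<open>C3\<close>.\<close>
  have C2': "e \<oplus>[p] f \<simeq> e" if "real_of_prob p = 1" for p and e f :: "'a pexp"
    using C2[of e f] that by (metis Sym real_of_prob_inverse)
  consider "real_of_prob p = 0" | "real_of_prob p = 1" | "0 < real_of_prob p" "real_of_prob p < 1"
    using real_of_prob_bounds[of p] by fastforce
  then show ?thesis
  proof cases
    case 1
    then have "e \<oplus>[p] f \<simeq> f"
      using Trans[OF C3[of e p f] C2'] by (simp add: prob_of_real_one)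
    then show ?thesis using 1 by (simp add: emb_eq_iff)
  next
    case 2
    then show ?thesis using C2' by (simp add: emb_eq_iff)
  next
    case 3
    then have "wgt p e + wgt (1 - p) f = emb (e \<oplus>[p] f)"
      by (simp add: wgt_add real_of_prob_inverse)
    with 3 show ?thesis
      by (simp flip: wgt_eq_scal_emb)
  qed
qed

abbreviation null :: "'a wexp" where "null \<equiv> emb \<zero>"

text \<open>By \<open>S0r\<close> the expression in \<open>w\<close> is absorbed and only its weight
  survives. Contributions of \<open>null\<close> can therefore be computed with real
  numbers.\<close>

lemma mult_null: "w * null = scal (height w) * null"
proof -
  obtain e where w: "w = scal (height w) * emb e" by (rule wexp_eq_scal_emb)
  have "emb e * null = null"
    by (simp add: emb_eq_iff S0r flip: emb_Seq)
  then show ?thesis by (subst w) (simp add: mult.assoc)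
qed

lemma null_mult: "null * w = scal (height w) * null"
proof -
  obtain e where w: "w = scal (height w) * emb e" by (rule wexp_eq_scal_emb)
  have "null * emb e = null"
    by (simp add: emb_eq_iff S0l flip: emb_Seq)
  then show ?thesis by (subst w) (simp add: scal_left_commute)
qed

section \<open>Guarded linear systems\<close>

text \<open>One representative with vanishing \<open>termE\<close> is demanded because
  \<open>Unique\<close> is applied to a representative of the coefficient.\<close>

definition guarded :: "'a wexp \<Rightarrow> bool" where
  "guarded w \<longleftrightarrow> (\<exists>r e. w = wgt r e \<and> termE e = 0)"

lemma guarded_emb: "termE e = 0 \<Longrightarrow> guarded (emb e)"
  by (auto simp: guarded_def)

lemma guardedE:
  assumes "guarded w"
  obtains e where "w = scal (height w) * emb e" "termE e = 0"
proof -
  obtain r e where re: "w = wgt r e" "termE e = 0"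
    using assms by (auto simp: guarded_def)
  then have "w = wgt (height w) e"
    by (auto simp: height_wgt wgt_eq_iff max_def intro: Refl)
  then show thesis using that re by (simp flip: wgt_eq_scal_emb)
qed

lemma guarded_0: "guarded 0"
  unfolding guarded_def by (rule exI[of _ 0], rule exI[of _ \<zero>]) (transfer, simp add: wrel_def)

lemma guarded_add:
  assumes "guarded v" "guarded w"
  shows "guarded (v + w)"
proof -
  obtain r e s f where vw: "v = wgt r e" "w = wgt s f" and E: "termE e = 0" "termE f = 0"
    using assms by (auto simp: guarded_def)
  show ?thesis
    unfolding guarded_def vw wgt_add
    by (rule exI[of _ "if r \<le> 0 then s else if s \<le> 0 then r else r + s"],
        rule exI[of _ "if r \<le> 0 then f else if s \<le> 0 then e else e \<oplus>[prob_of_real (r / (r + s))] f"])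
      (simp add: E)
qed

lemma guarded_mult:
  assumes "guarded v \<or> guarded w"
  shows "guarded (v * w)"
proof -
  obtain r e s f where vw: "v = wgt r e" "w = wgt s f" and E: "termE e = 0 \<or> termE f = 0"
    using assms by (metis guarded_def wexp_cases)
  have "v * w = wgt (if r \<le> 0 \<or> s \<le> 0 then 0 else r * s) (e \<odot> f)"
    unfolding vw by transfer (auto simp: wrel_def intro: Refl)
  with E show ?thesis
    unfolding guarded_def by (intro exI conjI) auto
qed

lemma guarded_sum: "(\<And>x. x \<in> S \<Longrightarrow> guarded (g x)) \<Longrightarrow> guarded (sum g S)"
  by (induction S rule: infinite_finite_induct) (auto intro: guarded_0 guarded_add)

text \<open>The pair \<open>s\<close>, \<open>z\<close> is chosen before \<open>b\<close> and
  \<open>x\<close>: the solution is an affine function of \<open>b\<close>, which is what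
  substitution into the other equations of a system requires. Below height 1, \<open>s\<close> acts
  as an inverse of \<open>1 - a\<close>. From height 1 on, balance kills \<open>b\<close> and the
  only solution of height \<open>h\<close> is a multiple of \<open>null\<close>.\<close>

lemma linear_equation:
  assumes a: "guarded a" and h: "0 \<le> h"
  shows "\<exists>s z. \<forall>b x. h = height a * h + height b \<longrightarrow>
    (height x = h \<and> x = a * x + b \<longleftrightarrow> x = s * b + z)"
proof -
  obtain e where e: "a = scal (height a) * emb e" "termE e = 0"
    using a by (rule guardedE)
  consider "h = 0" | "h > 0" "height a \<ge> 1" | "h > 0" "height a < 1"
    using h by linarith
  then show ?thesis
  proof cases
    case 1
    then show ?thesis
      by (intro exI[of _ 0]) auto
  next
    case 2
    \<comment> \<open>Since \<open>h\<close> is positive and \<open>height a\<close> is at least 1,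
      the balance equation leaves only \<open>b = 0\<close> and \<open>height a = 1\<close>.\<close>
    have "height x = h \<and> x = a * x + b \<longleftrightarrow> x = 0 * b + scal h * null"
      if hb: "h = height a * h + height b" for b x
    proof -
      have "h * height a \<ge> h * 1" using 2 by (intro mult_left_mono) auto
      then have "height b \<le> 0" using hb by (simp add: mult.commute)
      then have "height b = 0" using height_nonneg[of b] by linarith
      then have b: "b = 0" by simp
      with hb 2 have ha: "height a = 1" by simp
      then have a: "a = emb e" using e by simp
      have "x = scal h * null" if hx: "height x = h" "x = a * x"
      proof -
        obtain g where g: "x = scal h * emb g" using hx wexp_eq_scal_emb[of x] by auto
        have "scal h * emb g = a * (scal h * emb g)" using hx(2) unfolding g .
        also have "\<dots> = scal h * (emb e * emb g)" by (simp add: a scal_left_commute)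
        finally have "emb g = emb e * emb g" using 2 by (simp add: scal_cancel)
        \<comment> \<open>At parameter 1 the second branch of a choice is free; taking
          \<open>\<zero>\<close> there lets \<open>S0r\<close> collapse the loop that
          \<open>Unique\<close> produces.\<close>
        then have "emb g = emb (e \<odot> g \<oplus>[prob_of_real 1] \<zero>)"
          by (simp add: emb_Choice emb_Seq prob_of_real_one)
        then have "g \<simeq> e \<^bsup>[prob_of_real 1]\<^esup> \<odot> \<zero>"
          using e by (intro Unique) (simp_all add: emb_eq_iff)
        then show ?thesis using g by (metis emb_eq_iff S0r Trans)
      qed
      moreover have "a * (scal h * null) = scal h * null"
        using ha by (simp add: scal_left_commute mult_null[of a])
      moreover have "height (scal h * null) = h" using 2 by simp
      ultimately show ?thesis by (metis b mult_zero_left add_0_left add_0_right)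
    qed
    then show ?thesis by blast
  next
    case 3
    define p where "p = prob_of_real (height a)"
    have p: "real_of_prob p = height a"
      using 3 by (simp add: p_def real_of_prob_of_real)
    define L where "L = emb (e \<^bsup>[p]\<^esup>)"
    \<comment> \<open>The loop \<open>L\<close> has height 1 and satisfies
      \<open>L = a * L + scal (1 - height a)\<close>. Rescaling turns this into
      \<open>s = a * s + 1\<close>.\<close>
    define s where "s = scal (1 / (1 - height a)) * L"
    have "L = emb (e \<odot> e \<^bsup>[p]\<^esup> \<oplus>[p] \<one>)"
      unfolding L_def using Unroll[THEN Sym] by (simp add: emb_eq_iff)
    also have "\<dots> = a * L + scal (1 - height a)"
      by (subst e(1)) (simp add: emb_Choice emb_Seq L_def p mult.assoc)
    finally have L: "L = a * L + scal (1 - height a)" .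
    have "s = scal (1 / (1 - height a)) * (a * L + scal (1 - height a))"
      unfolding s_def by (simp flip: L)
    also have "\<dots> = a * s + 1"
      using 3 by (simp add: s_def distrib_left scal_left_commute flip: scal_mult)
    finally have s: "s = a * s + 1" .
    have hs: "height s = 1 / (1 - height a)" using 3 by (simp add: s_def L_def)
    have "height x = h \<and> x = a * x + b \<longleftrightarrow> x = s * b + 0"
      if hb: "h = height a * h + height b" for b x
    proof -
      have hb': "height b = h * (1 - height a)" using hb by (simp add: algebra_simps)
      have "x = s * b" if hx: "height x = h" "x = a * x + b"
      proof -
        obtain g where g: "x = scal h * emb g" using hx wexp_eq_scal_emb[of x] by auto
        obtain f where f: "b = scal (h * (1 - height a)) * emb f"
          using hb' wexp_eq_scal_emb[of b] by auto
        have "scal h * emb g = a * (scal h * emb g) + b" using hx(2) unfolding g .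
        also have "\<dots> = scal h * (a * emb g + scal (1 - height a) * emb f)"
          using 3 by (simp add: f scal_left_commute[of a] distrib_left scal_mult mult.assoc)
        finally have "emb g = a * emb g + scal (1 - height a) * emb f"
          using 3 by (simp add: scal_cancel)
        also have "\<dots> = emb (e \<odot> g \<oplus>[p] f)"
          by (subst e(1)) (simp add: emb_Choice emb_Seq p mult.assoc)
        finally have "emb g = L * emb f"
          using e Unique[of g e p f] by (simp add: L_def emb_eq_iff flip: emb_Seq)
        then have "x = scal h * (L * emb f)" by (simp add: g)
        also have "\<dots> = scal (1 / (1 - height a) * (h * (1 - height a))) * (L * emb f)"
          using 3 by simp
        also have "\<dots> = s * b"
          using 3 unfolding f s_def
          by (simp add: mult.assoc scal_left_commute[of L] scal_mult del: times_divide_eq_left)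
        finally show ?thesis .
      qed
      moreover have "s * b = a * (s * b) + b"
        by (subst s) (simp add: distrib_right mult.assoc)
      moreover have "height (s * b) = h" using 3 by (simp add: hs hb')
      ultimately show ?thesis by (metis add_0_right)
    qed
    then show ?thesis by blast
  qed
qed

text \<open>Gaussian elimination: the equation for \<open>n\<close> is solved by
  \<open>linear_equation\<close> and substituted into the others. Stating the result as an
  equivalence for every \<open>Y\<close> carries existence and uniqueness through the induction
  together. The heights must be prescribed, because \<open>x = a * x\<close> with
  \<open>height a = 1\<close> is solved by every nonnegative multiple of
  \<open>null\<close>.\<close>

lemma linear_system:
  assumes "finite I" "\<And>i j. guarded (A i j)" "\<And>i. i \<in> I \<Longrightarrow> 0 \<le> h i"
    "\<And>i. i \<in> I \<Longrightarrow> h i = (\<Sum>j\<in>I. height (A i j) * h j) + height (B i)"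
  shows "\<exists>X. \<forall>Y. (\<forall>i\<in>I. height (Y i) = h i \<and> Y i = (\<Sum>j\<in>I. A i j * Y j) + B i)
    \<longleftrightarrow> (\<forall>i\<in>I. Y i = X i)"
  using assms
proof (induction I arbitrary: A B rule: finite_induct)
  case empty
  then show ?case by simp
next
  case (insert n I)
  note gA = insert.prems(1) and h0 = insert.prems(2) and hA = insert.prems(3)
  obtain s z where sz: "\<And>b x. h n = height (A n n) * h n + height b \<Longrightarrow>
      (height x = h n \<and> x = A n n * x + b) \<longleftrightarrow> x = s * b + z"
    using linear_equation[OF gA h0, of n n n] by blast
  define R where "R Y = (\<Sum>j\<in>I. A n j * Y j) + B n" for Y
  \<comment> \<open>The new coefficients stay guarded because the rightmost factor
    \<open>A n j\<close> is guarded, whatever \<open>s\<close> is.\<close>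
  define A' where "A' i j = A i j + A i n * s * A n j" for i j
  define B' where "B' i = B i + A i n * (s * B n + z)" for i
  have hR: "h n = height (A n n) * h n + height (R Y)" if "\<forall>j\<in>I. height (Y j) = h j" for Y
    using hA[of n] insert.hyps that by (simp add: R_def)
  have hsz: "height (s * R Y + z) = h n" if "\<forall>j\<in>I. height (Y j) = h j" for Y
    using sz[OF hR[OF that], of "s * R Y + z"] by simp
  have AB': "(\<Sum>j\<in>I. A' i j * Y j) + B' i = A i n * (s * R Y + z) + (\<Sum>j\<in>I. A i j * Y j) + B i"
    for i Y
    by (simp add: A'_def B'_def R_def algebra_simps sum.distrib sum_distrib_left)
  have "\<exists>X. \<forall>Y. (\<forall>i\<in>I. height (Y i) = h i \<and> Y i = (\<Sum>j\<in>I. A' i j * Y j) + B' i)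
    \<longleftrightarrow> (\<forall>i\<in>I. Y i = X i)"
  proof (rule insert.IH)
    show "guarded (A' i j)" for i j
      unfolding A'_def using gA by (intro guarded_add guarded_mult disjI2) auto
    show "0 \<le> h i" if "i \<in> I" for i using h0 that by simp
    show "h i = (\<Sum>j\<in>I. height (A' i j) * h j) + height (B' i)" if i: "i \<in> I" for i
    proof -
      \<comment> \<open>Balance of the reduced system concerns heights only, so it can be read off
        from one test vector with the prescribed heights.\<close>
      define Y :: "'a \<Rightarrow> 'b wexp" where "Y j = scal (h j)" for j
      have Y: "\<forall>j\<in>I. height (Y j) = h j" using h0 by (simp add: Y_def)
      have "(\<Sum>j\<in>I. height (A' i j) * h j) + height (B' i)
          = height ((\<Sum>j\<in>I. A' i j * Y j) + B' i)"
        using Y by simp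
      also have "\<dots> = height (A i n) * h n + (\<Sum>j\<in>I. height (A i j) * h j) + height (B i)"
        unfolding AB' using Y hsz[OF Y] by simp
      also have "\<dots> = h i" using hA[of i] i insert.hyps by simp
      finally show ?thesis by simp
    qed
  qed
  then obtain X where X: "\<And>Y. (\<forall>i\<in>I. height (Y i) = h i \<and> Y i = (\<Sum>j\<in>I. A' i j * Y j) + B' i)
    \<longleftrightarrow> (\<forall>i\<in>I. Y i = X i)" by blast
  define X' where "X' = X(n := s * R X + z)"
  have "(\<forall>i\<in>insert n I. height (Y i) = h i \<and> Y i = (\<Sum>j\<in>insert n I. A i j * Y j) + B i)
      \<longleftrightarrow> (\<forall>i\<in>insert n I. Y i = X' i)" (is "?l \<longleftrightarrow> ?r") for Y
  proof -
    have RX: "R Y = R X" if "\<forall>i\<in>I. Y i = X i" using that by (simp add: R_def)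
    have n: "height (Y n) = h n \<and> Y n = (\<Sum>j\<in>insert n I. A n j * Y j) + B n \<longleftrightarrow> Y n = s * R Y + z"
      if "\<forall>j\<in>I. height (Y j) = h j"
      using sz[OF hR[OF that]] insert.hyps by (simp add: R_def add.assoc)
    have "?l \<longleftrightarrow> Y n = s * R Y + z \<and>
        (\<forall>i\<in>I. height (Y i) = h i \<and> Y i = (\<Sum>j\<in>insert n I. A i j * Y j) + B i)"
      using n by auto
    also have "\<dots> \<longleftrightarrow> Y n = s * R Y + z \<and>
        (\<forall>i\<in>I. height (Y i) = h i \<and> Y i = (\<Sum>j\<in>I. A' i j * Y j) + B' i)"
      using insert.hyps unfolding AB' by auto
    also have "\<dots> \<longleftrightarrow> Y n = s * R Y + z \<and> (\<forall>i\<in>I. Y i = X i)"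
      by (simp only: X)
    also have "\<dots> \<longleftrightarrow> Y n = s * R X + z \<and> (\<forall>i\<in>I. Y i = X i)"
      using RX by metis
    also have "\<dots> \<longleftrightarrow> ?r"
      using insert.hyps by (auto simp: X'_def)
    finally show ?thesis .
  qed
  then show ?case by blast
qed

text \<open>The heights of a given solution serve as the prescribed ones; applying
  \<open>height\<close> to its equations shows that they balance.\<close>

lemma linear_system_unique:
  assumes "finite I" "\<And>i j. guarded (A i j)" "\<And>i. i \<in> I \<Longrightarrow> height (X i) = height (Y i)"
    and X: "\<And>i. i \<in> I \<Longrightarrow> X i = (\<Sum>j\<in>I. A i j * X j) + B i"
    and Y: "\<And>i. i \<in> I \<Longrightarrow> Y i = (\<Sum>j\<in>I. A i j * Y j) + B i"
    and i: "i \<in> I"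
  shows "X i = Y i"
proof -
  have hX: "height (X i) = (\<Sum>j\<in>I. height (A i j) * height (X j)) + height (B i)" if "i \<in> I" for i
    using arg_cong[OF X[OF that], of height] by simp
  obtain W where W: "\<And>Y. (\<forall>i\<in>I. height (Y i) = height (X i) \<and> Y i = (\<Sum>j\<in>I. A i j * Y j) + B i)
      \<longleftrightarrow> (\<forall>i\<in>I. Y i = W i)"
    using linear_system[of I A "\<lambda>i. height (X i)" B, OF assms(1,2) height_nonneg hX] by blast
  have "\<forall>i\<in>I. X i = W i" unfolding W[symmetric] using X by blast
  moreover have "\<forall>i\<in>I. Y i = W i" unfolding W[symmetric] using Y assms(3) by auto
  ultimately show ?thesis using i by simp
qed

section \<open>The fundamental theorem\<close>

primrec step :: "('a, 'a pexp) F \<Rightarrow> 'a wexp" where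
  "step (Inl u) = 1"
| "step (Inr x) = emb (Atom (fst x)) * emb (snd x)"

definition lin :: "(('a, 'a pexp) F \<Rightarrow> real) \<Rightarrow> 'a wexp" where
  "lin \<nu> = (\<Sum>x | \<nu> x \<noteq> 0. scal (\<nu> x) * step x)"

definition nonneg_fin :: "('x \<Rightarrow> real) \<Rightarrow> bool" where
  "nonneg_fin \<nu> \<longleftrightarrow> finite {x. \<nu> x \<noteq> 0} \<and> (\<forall>x. 0 \<le> \<nu> x)"

lemma nonneg_fin_antimirov: "nonneg_fin (\<partial> e)"
  using antimirov_subdist[of e] subdist_bounds[of "\<partial> e"] by (simp add: nonneg_fin_def subdist_def)

lemma nonneg_fin_push: "nonneg_fin (push f (\<partial> e))"
proof -
  obtain T where "finite T" "\<And>x. x \<notin> T \<Longrightarrow> push f (\<partial> e) x = 0" "\<And>x. 0 \<le> push f (\<partial> e) x"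
    using push_mass[OF antimirov_subdist, of f e] by blast
  then show ?thesis
    unfolding nonneg_fin_def by (auto intro: finite_subset[of _ T])
qed

lemma lin_eq_sum:
  assumes "finite S" "\<And>x. \<nu> x \<noteq> 0 \<Longrightarrow> x \<in> S"
  shows "lin \<nu> = (\<Sum>x\<in>S. scal (\<nu> x) * step x)"
  unfolding lin_def using assms by (intro sum.mono_neutral_left) auto

lemma lin_0: "lin (\<lambda>_. 0) = 0"
  by (simp add: lin_def)

lemma lin_dirac: "lin (\<delta> x) = step x"
  by (subst lin_eq_sum[of "{x}"]) (auto simp: dirac_def split: if_splits)

lemma lin_combine:
  assumes "nonneg_fin \<nu>" "nonneg_fin \<mu>" "0 \<le> r" "0 \<le> s"
  shows "lin (\<lambda>x. r * \<nu> x + s * \<mu> x) = scal r * lin \<nu> + scal s * lin \<mu>"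
proof -
  let ?S = "{x. \<nu> x \<noteq> 0} \<union> {x. \<mu> x \<noteq> 0}"
  have S: "finite ?S" "\<And>x. 0 \<le> \<nu> x" "\<And>x. 0 \<le> \<mu> x" using assms by (auto simp: nonneg_fin_def)
  have "lin (\<lambda>x. r * \<nu> x + s * \<mu> x) = (\<Sum>x\<in>?S. scal (r * \<nu> x + s * \<mu> x) * step x)"
    using S by (intro lin_eq_sum) auto
  also have "\<dots> = scal r * (\<Sum>x\<in>?S. scal (\<nu> x) * step x) + scal s * (\<Sum>x\<in>?S. scal (\<mu> x) * step x)"
    using S assms
    by (simp add: scal_add scal_mult distrib_right mult.assoc sum.distrib sum_distrib_left)
  also have "\<dots> = scal r * lin \<nu> + scal s * lin \<mu>"
    using S by (subst (1 2) lin_eq_sum[of ?S]) auto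
  finally show ?thesis .
qed

lemma lin_split_tick:
  assumes "nonneg_fin \<nu>"
  shows "lin \<nu> = scal (\<nu> \<checkmark>) + lin (\<nu>(\<checkmark> := 0))"
proof -
  let ?S = "{x. \<nu> x \<noteq> 0}"
  have S: "finite ?S" using assms by (simp add: nonneg_fin_def)
  have "lin \<nu> = (\<Sum>x\<in>insert \<checkmark> ?S. scal (\<nu> x) * step x)"
    using S by (intro lin_eq_sum) auto
  also have "\<dots> = scal (\<nu> \<checkmark>) + (\<Sum>x\<in>?S - {\<checkmark>}. scal (\<nu> x) * step x)"
    using S by (subst sum.insert_remove) auto
  also have "(\<Sum>x\<in>?S - {\<checkmark>}. scal (\<nu> x) * step x)
      = (\<Sum>x\<in>?S - {\<checkmark>}. scal ((\<nu>(\<checkmark> := 0)) x) * step x)"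
    by (rule sum.cong) auto
  also have "\<dots> = lin (\<nu>(\<checkmark> := 0))"
    using S by (intro lin_eq_sum[symmetric]) (auto split: if_splits)
  finally show ?thesis .
qed

text \<open>The map from \<open>e'\<close> to \<open>e' \<odot> f\<close> is injective, so
  coefficients are carried over unchanged, and associativity moves \<open>f\<close> out to the right
  of every summand.\<close>

lemma lin_push:
  assumes "nonneg_fin \<nu>"
  shows "lin (push f \<nu>) = lin (\<nu>(\<checkmark> := 0)) * emb f"
proof -
  define S where "S = {x. \<nu> x \<noteq> 0} - {\<checkmark>}"
  define h :: "('a, 'a pexp) F \<Rightarrow> ('a, 'a pexp) F" where "h = map_sum id (map_prod id (\<lambda>e'. e' \<odot> f))"
  have S: "finite S" using assms by (simp add: nonneg_fin_def S_def)
  have nt: "x \<noteq> \<checkmark>" if "x \<in> S" for x using that by (simp add: S_def)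
  have inj: "inj_on h S"
    by (auto simp: inj_on_def h_def map_sum_def map_prod_def split: sum.splits)
  have supp: "x \<in> h ` S" if x: "push f \<nu> x \<noteq> 0" for x
  proof (cases x)
    case (Inr b)
    obtain a g where b: "b = (a, g)" by (cases b)
    obtain e' where g: "g = e' \<odot> f"
      using x Inr b push_eq_0[of g f \<nu> a] by blast
    then have "Inr (a, e') \<in> S" using x Inr b by (simp add: push_simps S_def)
    then show ?thesis using Inr b g by (force simp: h_def)
  qed (use x in \<open>simp add: push_simps\<close>)
  have "lin (push f \<nu>) = (\<Sum>x\<in>h ` S. scal (push f \<nu> x) * step x)"
    using S supp by (intro lin_eq_sum) auto
  also have "\<dots> = (\<Sum>x\<in>S. scal (push f \<nu> (h x)) * step (h x))"
    by (simp add: sum.reindex[OF inj])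
  also have "\<dots> = (\<Sum>x\<in>S. scal ((\<nu>(\<checkmark> := 0)) x) * step x * emb f)"
  proof (rule sum.cong)
    fix x assume "x \<in> S"
    then show "scal (push f \<nu> (h x)) * step (h x) = scal ((\<nu>(\<checkmark> := 0)) x) * step x * emb f"
      using nt[of x] by (cases x) (auto simp: h_def push_simps emb_Seq mult.assoc)
  qed simp
  also have "\<dots> = lin (\<nu>(\<checkmark> := 0)) * emb f"
    using S by (subst lin_eq_sum[of S]) (auto simp: S_def sum_distrib_right split: if_splits)
  finally show ?thesis .
qed

text \<open>In the loop case the termination probability of the body is first removed by \<open>Tight\<close>.\<close>

lemma fundamental_ex: "\<exists>c\<ge>0. emb e = lin (\<partial> e) + scal c * null"
proof (induction e)
  case Zero
  show ?case by (rule exI[of _ 1]) (simp add: lin_0)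
next
  case One
  show ?case by (rule exI[of _ 0]) (simp add: lin_dirac)
next
  case (Atom a)
  show ?case by (rule exI[of _ 0]) (simp add: lin_dirac)
next
  case (Choice e p f)
  then obtain c d where cd: "0 \<le> c" "emb e = lin (\<partial> e) + scal c * null"
    "0 \<le> d" "emb f = lin (\<partial> f) + scal d * null" by blast
  have p: "0 \<le> real_of_prob p" "0 \<le> 1 - real_of_prob p" using real_of_prob_bounds[of p] by auto
  have "emb (e \<oplus>[p] f) = lin (\<partial> (e \<oplus>[p] f)) + scal (p * c + (1 - p) * d) * null"
    using p cd unfolding emb_Choice cd(2,4)
    by (simp add: lin_combine nonneg_fin_antimirov scal_add scal_mult distrib_left distrib_right mult.assoc add_ac)
  then show ?case using cd p by (intro exI[of _ "p * c + (1 - p) * d"]) auto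
next
  case (Seq e f)
  then obtain c d where cd: "0 \<le> c" "emb e = lin (\<partial> e) + scal c * null"
    "0 \<le> d" "emb f = lin (\<partial> f) + scal d * null" by blast
  have \<epsilon>: "0 \<le> \<partial> e \<checkmark>" using nonneg_fin_antimirov[of e] by (simp add: nonneg_fin_def)
  define R where "R = lin ((\<partial> e)(\<checkmark> := 0))"
  have "lin (\<partial> (e \<odot> f)) = lin (\<lambda>x. \<partial> e \<checkmark> * \<partial> f x + 1 * push f (\<partial> e) x)"
    by (simp add: antimirov_Seq_push[abs_def] del: antimirov.simps)
  also have "\<dots> = scal (\<partial> e \<checkmark>) * lin (\<partial> f) + R * emb f"
    using \<epsilon> by (subst lin_combine) (simp_all add: nonneg_fin_antimirov nonneg_fin_push lin_push R_def)
  finally have *: "lin (\<partial> (e \<odot> f)) = \<dots>" .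
  have "emb (e \<odot> f) = (scal (\<partial> e \<checkmark>) + R + scal c * null) * emb f"
    unfolding emb_Seq by (subst cd(2)) (simp only: lin_split_tick[OF nonneg_fin_antimirov] R_def)
  also have "\<dots> = scal (\<partial> e \<checkmark>) * emb f + R * emb f + scal c * (null * emb f)"
    by (simp add: distrib_right mult.assoc)
  also have "null * emb f = null" using null_mult[of "emb f"] by simp
  also have "scal (\<partial> e \<checkmark>) * emb f = scal (\<partial> e \<checkmark>) * lin (\<partial> f) + scal (\<partial> e \<checkmark> * d) * null"
    using \<epsilon> cd by (subst cd(4)) (simp add: distrib_left scal_mult mult.assoc)
  finally have "emb (e \<odot> f) = lin (\<partial> (e \<odot> f)) + scal (\<partial> e \<checkmark> * d + c) * null"
    using \<epsilon> cd(1,3) unfolding * by (simp add: scal_add distrib_right add_ac)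
  then show ?case using \<epsilon> cd by (intro exI[of _ "\<partial> e \<checkmark> * d + c"]) auto
next
  case (Loop e p)
  then obtain c where c: "0 \<le> c" "emb e = lin (\<partial> e) + scal c * null" by blast
  define \<epsilon> where "\<epsilon> = \<partial> e \<checkmark>"
  define R where "R = lin ((\<partial> e)(\<checkmark> := 0))"
  have e: "emb e = scal \<epsilon> + (R + scal c * null)"
    unfolding \<epsilon>_def R_def c(2) by (subst lin_split_tick[OF nonneg_fin_antimirov]) (simp add: add.assoc)
  have \<epsilon>0: "0 \<le> \<epsilon>" using nonneg_fin_antimirov[of e] by (simp add: nonneg_fin_def \<epsilon>_def)
  have hR: "height (R + scal c * null) = 1 - \<epsilon>"
    using arg_cong[OF e, of height] \<epsilon>0 by simp
  then have \<epsilon>1: "\<epsilon> \<le> 1" using height_nonneg[of "R + scal c * null"] by linarith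
  \<comment> \<open>Normalising the part of \<open>e\<close> other than its tick gives
    \<open>e \<simeq> g \<oplus>[r] \<one>\<close>, the shape of loop body that \<open>Tight\<close>
    expects.\<close>
  obtain g where g: "R + scal c * null = scal (1 - \<epsilon>) * emb g"
    using wexp_eq_scal_emb[of "R + scal c * null"] hR by metis
  define r where "r = prob_of_real (1 - \<epsilon>)"
  have r: "real_of_prob r = 1 - \<epsilon>" using \<epsilon>0 \<epsilon>1 by (simp add: r_def real_of_prob_of_real)
  have "emb e = emb (g \<oplus>[r] \<one>)"
    unfolding e g emb_Choice by (simp add: r add.commute)
  then have eg: "e \<^bsup>[p]\<^esup> \<simeq> (g \<oplus>[r] \<one>) \<^bsup>[p]\<^esup>" by (simp add: emb_eq_iff Cong_loop)
  have p: "0 \<le> real_of_prob p" "real_of_prob p \<le> 1" using real_of_prob_bounds[of p] by auto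
  show ?case
  proof (cases "real_of_prob p = 1 \<and> \<epsilon> = 1")
    case True
    then have "R + scal c * null = 0" using hR by (metis height_eq_0_iff diff_self)
    with e True have "emb e = emb \<one>" by simp
    then have "e \<^bsup>[p]\<^esup> \<simeq> \<one> \<^bsup>[p]\<^esup>" by (simp add: emb_eq_iff Cong_loop del: emb_One)
    moreover have "p = prob_of_real 1" using True by (metis real_of_prob_inverse)
    ultimately have "e \<^bsup>[p]\<^esup> \<simeq> \<zero>" using Div Trans by blast
    then have "emb (e \<^bsup>[p]\<^esup>) = null" by (simp add: emb_eq_iff)
    moreover have "lin (\<partial> (e \<^bsup>[p]\<^esup>)) = 0"
      using True by (simp add: \<epsilon>_def lin_0)
    ultimately show ?thesis by (intro exI[of _ 1]) simp
  next
    case False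
    define d where "d = 1 - p * \<epsilon>"
    have "p * \<epsilon> < 1"
    proof (cases "real_of_prob p = 1")
      case True
      then show ?thesis using False \<epsilon>1 by simp
    next
      case False
      then show ?thesis using p \<epsilon>0 \<epsilon>1 mult_left_le[of \<epsilon> "real_of_prob p"] by linarith
    qed
    then have d: "0 < d" by (simp add: d_def)
    define q where "q = prob_of_real (r * p / (1 - (1 - r) * p))"
    define L where "L = emb (e \<^bsup>[p]\<^esup>)"
    have den: "1 - (1 - r) * p = d" by (simp add: r d_def mult.commute)
    \<comment> \<open>These are the coefficients in the derivative of the loop: \<open>k\<close> for
      the pushed derivative of the body and \<open>m\<close> for the tick. The parameter
      \<open>q\<close> from \<open>Tight\<close> equals \<open>(1 - \<epsilon>) * k\<close> and has
      complement \<open>m\<close>, so unrolling the tightened loop once reproduces them.\<close>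
    define k where "k = p / d"
    define m where "m = (1 - p) / d"
    have m: "0 \<le> m" using p d by (simp add: m_def)
    have k: "0 \<le> k" using p d by (simp add: k_def)
    have q: "real_of_prob q = (1 - \<epsilon>) * k"
      unfolding q_def k_def using prob_of_real_Tight[of r p] d unfolding den by (simp add: r)
    have q': "1 - (1 - \<epsilon>) * k = m"
      using d by (simp add: k_def m_def field_simps d_def)
    have "e \<^bsup>[p]\<^esup> \<simeq> g \<^bsup>[q]\<^esup>"
      using Trans[OF eg Trans[OF S1r[THEN Sym] Tight[of r p g]]] d unfolding q_def den by simp
    then have L: "L = emb (g \<^bsup>[q]\<^esup>)" by (simp add: L_def emb_eq_iff)
    have "L = emb (g \<odot> g \<^bsup>[q]\<^esup> \<oplus>[q] \<one>)"
      unfolding L using Unroll[THEN Sym] by (simp add: emb_eq_iff)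
    also have "\<dots> = scal ((1 - \<epsilon>) * k) * (emb g * L) + scal m"
      by (simp add: emb_Choice emb_Seq q q' flip: L)
    also have "\<dots> = scal k * ((scal (1 - \<epsilon>) * emb g) * L) + scal m"
      using k by (simp add: mult.assoc mult.commute[of _ k] scal_mult)
    also have "\<dots> = scal k * (R * L) + scal k * (scal c * (null * L)) + scal m"
      by (simp add: distrib_left distrib_right mult.assoc flip: g)
    also have "null * L = null" using null_mult[of L] by (simp add: L_def)
    also have "scal k * (scal c * null) = scal (k * c) * null"
      using k by (simp add: scal_mult mult.assoc)
    also have "scal k * (R * L) + scal (k * c) * null + scal m
        = (scal m * 1 + scal k * (R * L)) + scal (k * c) * null"
      by (simp add: add_ac)
    also have "scal m * 1 + scal k * (R * L) = lin (\<partial> (e \<^bsup>[p]\<^esup>))"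
    proof -
      have "nonneg_fin (\<delta> (\<checkmark> :: ('a, 'a pexp) F))"
        by (auto simp: nonneg_fin_def dirac_def)
      moreover have "\<partial> (e \<^bsup>[p]\<^esup>) = (\<lambda>x. m * \<delta> \<checkmark> x + k * push (e \<^bsup>[p]\<^esup>) (\<partial> e) x)"
        using antimirov_Loop_push[of p e] False
        by (intro ext) (simp add: k_def m_def d_def \<epsilon>_def add_divide_distrib del: antimirov.simps)
      ultimately show ?thesis
        using m k by (simp add: lin_combine nonneg_fin_push lin_dirac lin_push nonneg_fin_antimirov R_def L_def
            del: antimirov.simps)
    qed
    finally show ?thesis using k c unfolding L_def
      by (intro exI[of _ "k * c"]) (simp del: antimirov.simps)
  qed
qed

section \<open>A finite set of expressions closed under derivatives\<close>

lemma antimirov_nonneg: "0 \<le> \<partial> e x"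
  by (rule subdist_bounds(1)[OF antimirov_subdist])

text \<open>A structurally defined superset of the expressions reachable from \<open>e\<close> by
  derivatives; its finiteness makes the systems below finite. The clause for
  \<open>e \<odot> f\<close> includes \<open>derivs f\<close> because \<open>e\<close> may
  terminate.\<close>

primrec derivs :: "'a pexp \<Rightarrow> 'a pexp set" where
  "derivs \<zero> = {\<zero>}"
| "derivs \<one> = {\<one>}"
| "derivs (Atom a) = {Atom a, \<one>}"
| "derivs (e \<oplus>[p] f) = insert (e \<oplus>[p] f) (derivs e \<union> derivs f)"
| "derivs (e \<odot> f) = (\<lambda>x. x \<odot> f) ` derivs e \<union> derivs f"
| "derivs (e \<^bsup>[p]\<^esup>) = insert (e \<^bsup>[p]\<^esup>) ((\<lambda>x. x \<odot> e \<^bsup>[p]\<^esup>) ` derivs e)"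

lemma finite_derivs: "finite (derivs e)"
  by (induction e) auto

lemma self_derivs: "e \<in> derivs e"
  by (induction e) auto

lemma antimirov_SeqD:
  assumes "\<partial> (e \<odot> f) (Inr (a, g)) \<noteq> 0"
  shows "\<partial> f (Inr (a, g)) \<noteq> 0 \<or> (\<exists>e'. g = e' \<odot> f \<and> \<partial> e (Inr (a, e')) \<noteq> 0)"
  using assms unfolding antimirov_Seq_push
  by (metis push_eq_0 push_simps(2) mult_zero_right add_0)

lemma antimirov_LoopD:
  assumes "\<partial> (e \<^bsup>[p]\<^esup>) (Inr (a, g)) \<noteq> 0"
  shows "\<exists>e'. g = e' \<odot> e \<^bsup>[p]\<^esup> \<and> \<partial> e (Inr (a, e')) \<noteq> 0"
  using assms by (auto split: if_splits pexp.splits)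

lemma derivs_closed: "x \<in> derivs e \<Longrightarrow> \<partial> x (Inr (a, g)) \<noteq> 0 \<Longrightarrow> g \<in> derivs e"
proof (induction e arbitrary: x g)
  case (Choice e p f)
  show ?case
  proof (cases "x = e \<oplus>[p] f")
    case True
    with Choice.prems have "\<partial> e (Inr (a, g)) \<noteq> 0 \<or> \<partial> f (Inr (a, g)) \<noteq> 0" by auto
    then show ?thesis using Choice.IH[OF self_derivs] by auto
  qed (use Choice in auto)
next
  case (Seq e f)
  show ?case
  proof (cases "x \<in> derivs f")
    case False
    then obtain e' where e': "x = e' \<odot> f" "e' \<in> derivs e" using Seq.prems by auto
    then show ?thesis
      using antimirov_SeqD[of e' f a g] Seq.prems(2) Seq.IH(1)[of e'] Seq.IH(2)[OF self_derivs]
      by auto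
  qed (use Seq in auto)
next
  case (Loop e p)
  have *: "g \<in> derivs (e \<^bsup>[p]\<^esup>)" if "\<partial> (e \<^bsup>[p]\<^esup>) (Inr (a, g)) \<noteq> 0" for g
    using antimirov_LoopD[OF that] Loop.IH[OF self_derivs] by auto
  show ?case
  proof (cases "x = e \<^bsup>[p]\<^esup>")
    case False
    then obtain e' where e': "x = e' \<odot> e \<^bsup>[p]\<^esup>" "e' \<in> derivs e" using Loop.prems by auto
    then show ?thesis
      using antimirov_SeqD[of e' "e \<^bsup>[p]\<^esup>" a g] Loop.prems(2) Loop.IH[of e'] * by auto
  qed (use Loop.prems * in simp)
qed (auto simp: dirac_def split: if_splits)

section \<open>Completeness\<close>

text \<open>The total weight of the words of length \<open>n\<close>. Taking an arbitrary function
  on words as argument makes it applicable to linear combinations of languages and dependent on the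
  language alone.\<close>

primrec lmass :: "nat \<Rightarrow> ('a::finite list \<Rightarrow> real) \<Rightarrow> real" where
  "lmass 0 l = l []"
| "lmass (Suc n) l = (\<Sum>a\<in>UNIV. lmass n (\<lambda>v. l (a # v)))"

lemma lmass_linear: "lmass n (\<lambda>v. \<Sum>i\<in>I. c i * l i v) = (\<Sum>i\<in>I. c i * lmass n (l i))"
proof (induction n arbitrary: l)
  case (Suc n)
  then show ?case by (simp add: sum_distrib_left) (rule sum.swap)
qed simp

lemma lmass_nonneg: "(\<And>v. 0 \<le> l v) \<Longrightarrow> 0 \<le> lmass n l"
  by (induction n arbitrary: l) (auto intro: sum_nonneg)

lemma prob_lang_nonneg: "0 \<le> \<lbrakk>e\<rbrakk> v"
  by (induction v arbitrary: e) (auto intro!: sum_nonneg mult_nonneg_nonneg simp: antimirov_nonneg)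

text \<open>One generator is chosen for each possible support: subtracting its largest possible
  multiple from a vector with the same support makes the support smaller.\<close>

lemma cone_generators:
  fixes J :: "'i set"
  assumes J: "finite J" and V: "\<And>t y z. y \<in> V \<Longrightarrow> z \<in> V \<Longrightarrow> (\<lambda>i. y i - t * z i) \<in> V"
    and ne: "V \<noteq> {}"
  defines "Z \<equiv> {z \<in> V. (\<forall>i. 0 \<le> z i) \<and> (\<forall>i. i \<notin> J \<longrightarrow> z i = (0::real))}"
  obtains g where "\<And>S. g S \<in> Z"
    and "\<And>z. z \<in> Z \<Longrightarrow> \<exists>c. (\<forall>S. 0 \<le> c S) \<and> z = (\<lambda>i. \<Sum>S\<in>Pow J. c S * g S i)"
proof -
  obtain v where "v \<in> V" using ne by blast
  then have z0: "(\<lambda>_. 0) \<in> Z" using V[of v v 1] by (simp add: Z_def)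
  \<comment> \<open>A support not realised in \<open>Z\<close> is assigned an arbitrary element of
    \<open>Z\<close>, so that \<open>g S\<close> lies in \<open>Z\<close> for every
    \<open>S\<close>.\<close>
  have "\<exists>z. z \<in> Z \<and> ((\<exists>y\<in>Z. {i. y i \<noteq> 0} = S) \<longrightarrow> {i. z i \<noteq> 0} = S)" for S
    using z0 by blast
  then have "\<exists>g. \<forall>S. g S \<in> Z \<and> ((\<exists>y\<in>Z. {i. y i \<noteq> 0} = S) \<longrightarrow> {i. g S i \<noteq> 0} = S)"
    by (intro choice allI)
  then obtain g where "\<And>S. g S \<in> Z \<and> ((\<exists>y\<in>Z. {i. y i \<noteq> 0} = S) \<longrightarrow> {i. g S i \<noteq> 0} = S)"
    by blast
  then have gZ: "\<And>S. g S \<in> Z" and gS: "\<And>y. y \<in> Z \<Longrightarrow> {i. g {i. y i \<noteq> 0} i \<noteq> 0} = {i. y i \<noteq> 0}"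
    by blast+
  have "\<exists>c. (\<forall>S. 0 \<le> c S) \<and> z = (\<lambda>i. \<Sum>S\<in>Pow J. c S * g S i)" if "z \<in> Z" for z
    using that
  proof (induction "card {i. z i \<noteq> 0}" arbitrary: z rule: less_induct)
    case less
    define S where "S = {i. z i \<noteq> 0}"
    have SJ: "S \<subseteq> J" using less.prems by (auto simp: Z_def S_def)
    then have fS: "finite S" using J finite_subset by blast
    show ?case
    proof (cases "S = {}")
      case True
      then have "z = (\<lambda>_. 0)" by (auto simp: S_def)
      then show ?thesis by (intro exI[of _ "\<lambda>_. 0"]) auto
    next
      case False
      define y where "y = g S"
      have y: "y \<in> Z" "\<And>i. y i \<noteq> 0 \<longleftrightarrow> i \<in> S"
        using gZ[of S] gS[OF less.prems] by (auto simp: y_def S_def)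
      have pos: "0 < y i" "0 < z i" if "i \<in> S" for i
        using that y less.prems by (auto simp: Z_def S_def less_le)
      define t where "t = Min ((\<lambda>i. z i / y i) ` S)"
      have tle: "t \<le> z i / y i" if "i \<in> S" for i
        using that fS by (simp add: t_def)
      have "t \<in> (\<lambda>i. z i / y i) ` S"
        unfolding t_def using fS False by (intro Min_in) auto
      then obtain k where k: "k \<in> S" "t = z k / y k" by blast
      have t0: "0 \<le> t" using pos[of k] k by simp
      define z' where "z' i = z i - t * y i" for i
      have "z' \<in> V" using V[of z y t] less.prems y by (simp add: Z_def z'_def[abs_def])
      moreover have "0 \<le> z' i" for i
      proof (cases "i \<in> S")
        case True
        then show ?thesis using tle[of i] pos[of i] by (simp add: z'_def field_simps)
      next
        case False
        then show ?thesis using y(2)[of i] by (simp add: z'_def S_def)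
      qed
      moreover have sub: "z' i = 0" if "i \<notin> S" for i
        using that y(2)[of i] by (simp add: z'_def S_def)
      ultimately have z': "z' \<in> Z" using SJ by (auto simp: Z_def)
      have "z' k = 0" using k pos[of k] by (simp add: z'_def)
      then have "{i. z' i \<noteq> 0} \<subset> S" using sub k by auto
      then have "card {i. z' i \<noteq> 0} < card {i. z i \<noteq> 0}"
        using fS psubset_card_mono unfolding S_def by blast
      then obtain c where c: "\<forall>S. 0 \<le> c S" "z' = (\<lambda>i. \<Sum>S\<in>Pow J. c S * g S i)"
        using less.hyps z' by blast
      \<comment> \<open>The multiple \<open>t\<close> of \<open>g S\<close> that was subtracted is
        returned to the coefficient of \<open>S\<close>.\<close>
      have "z i = (\<Sum>T\<in>Pow J. (c(S := c S + t)) T * g T i)" for i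
      proof -
        have "(\<Sum>T\<in>Pow J. (c(S := c S + t)) T * g T i)
            = (\<Sum>T\<in>Pow J. c T * g T i + (if T = S then t * g T i else 0))"
          by (rule sum.cong) (auto simp: algebra_simps)
        also have "\<dots> = z' i + t * y i"
          using SJ J by (simp add: sum.distrib c(2) y_def)
        finally show ?thesis by (simp add: z'_def)
      qed
      then show ?thesis using c t0 by (intro exI[of _ "c(S := c S + t)"]) auto
    qed
  qed
  then show thesis using that gZ by blast
qed

section \<open>Masses and linear systems over a derivative-closed set\<close>

locale derivative_closed =
  fixes I :: "'a::finite pexp set"
  assumes finite_I: "finite I"
    and closed: "\<And>x a y. x \<in> I \<Longrightarrow> \<partial> x (Inr (a, y)) \<noteq> 0 \<Longrightarrow> y \<in> I"
begin

definition tr :: "'a pexp \<Rightarrow> 'a pexp \<Rightarrow> 'a wexp" where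
  "tr x y = (\<Sum>a\<in>UNIV. scal (\<partial> x (Inr (a, y))) * emb (Atom a))"

lemma guarded_tr: "guarded (tr x y)"
  unfolding tr_def by (intro guarded_sum guarded_mult disjI2 guarded_emb) simp

lemma height_tr: "height (tr x y) = (\<Sum>a\<in>UNIV. \<partial> x (Inr (a, y)))"
  by (simp add: tr_def antimirov_nonneg)

text \<open>The mass that the derivative of \<open>x\<close> lacks for being a full probability
  distribution.\<close>

definition deficit :: "'a pexp \<Rightarrow> real" where
  "deficit x = 1 - \<partial> x \<checkmark> - (\<Sum>y\<in>I. height (tr x y))"

lemma lin_antimirov:
  assumes "x \<in> I"
  shows "lin (\<partial> x) = (\<Sum>y\<in>I. tr x y * emb y) + scal (\<partial> x \<checkmark>)"
proof -
  have "lin (\<partial> x) = (\<Sum>u\<in>insert \<checkmark> (Inr ` (UNIV \<times> I)). scal (\<partial> x u) * step u)"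
  proof (rule lin_eq_sum)
    show "u \<in> insert \<checkmark> (Inr ` (UNIV \<times> I))" if "\<partial> x u \<noteq> 0" for u
      using that closed[OF assms] by (cases u) auto
  qed (use finite_I in auto)
  also have "\<dots> = scal (\<partial> x \<checkmark>) + (\<Sum>u\<in>UNIV \<times> I. scal (\<partial> x (Inr u)) * step (Inr u))"
    using finite_I by (subst sum.insert) (auto simp: sum.reindex)
  also have "(\<Sum>u\<in>UNIV \<times> I. scal (\<partial> x (Inr u)) * step (Inr u))
      = (\<Sum>a\<in>UNIV. \<Sum>y\<in>I. scal (\<partial> x (Inr (a, y))) * (emb (Atom a) * emb y))"
    by (simp add: sum.cartesian_product case_prod_unfold)
  also have "\<dots> = (\<Sum>y\<in>I. tr x y * emb y)"
    by (subst sum.swap) (simp add: tr_def sum_distrib_right mult.assoc)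
  finally show ?thesis by (simp add: add.commute)
qed

text \<open>Comparing heights on both sides determines the weight of \<open>null\<close> that
  \<open>fundamental_ex\<close> leaves existential. Its nonnegativity also says that the derivative
  has mass at most 1.\<close>

lemma fundamental:
  assumes "x \<in> I"
  shows "emb x = (\<Sum>y\<in>I. tr x y * emb y) + (scal (\<partial> x \<checkmark>) + scal (deficit x) * null)"
    and "0 \<le> deficit x"
proof -
  obtain c where c: "0 \<le> c" "emb x = (\<Sum>y\<in>I. tr x y * emb y) + scal (\<partial> x \<checkmark>) + scal c * null"
    using fundamental_ex[of x] lin_antimirov[OF assms] by auto
  have "c = deficit x"
    using arg_cong[OF c(2), of height] c(1) by (simp add: deficit_def antimirov_nonneg)
  with c show "emb x = (\<Sum>y\<in>I. tr x y * emb y) + (scal (\<partial> x \<checkmark>) + scal (deficit x) * null)"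
    and "0 \<le> deficit x" by (simp_all add: add.assoc)
qed

lemma prob_lang_Cons:
  assumes "x \<in> I"
  shows "\<lbrakk>x\<rbrakk> (a # v) = (\<Sum>y\<in>I. \<partial> x (Inr (a, y)) * \<lbrakk>y\<rbrakk> v)"
  using closed[OF assms] finite_I by (simp del: antimirov.simps) (intro sum.mono_neutral_left; auto)

lemma lmass_Suc:
  assumes "x \<in> I"
  shows "lmass (Suc n) \<lbrakk>x\<rbrakk> = (\<Sum>y\<in>I. height (tr x y) * lmass n \<lbrakk>y\<rbrakk>)"
proof -
  have "lmass (Suc n) \<lbrakk>x\<rbrakk> = (\<Sum>a\<in>UNIV. \<Sum>y\<in>I. \<partial> x (Inr (a, y)) * lmass n \<lbrakk>y\<rbrakk>)"
    using prob_lang_Cons[OF assms] by (simp add: lmass_linear del: prob_lang.simps)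
  also have "\<dots> = (\<Sum>y\<in>I. height (tr x y) * lmass n \<lbrakk>y\<rbrakk>)"
    by (subst sum.swap) (simp add: height_tr sum_distrib_right)
  finally show ?thesis .
qed

text \<open>Splitting off the empty word reduces the bound for \<open>x\<close> to those for its
  derivatives; what remains is at most 1 because \<open>deficit x\<close> is nonnegative.\<close>

lemma sum_lmass_le: "x \<in> I \<Longrightarrow> (\<Sum>n<N. lmass n \<lbrakk>x\<rbrakk>) \<le> 1"
proof (induction N arbitrary: x)
  case (Suc N)
  have "(\<Sum>n<Suc N. lmass n \<lbrakk>x\<rbrakk>) = \<partial> x \<checkmark> + (\<Sum>n<N. lmass (Suc n) \<lbrakk>x\<rbrakk>)"
    by (subst sum.lessThan_Suc_shift) simp
  also have "(\<Sum>n<N. lmass (Suc n) \<lbrakk>x\<rbrakk>) = (\<Sum>y\<in>I. height (tr x y) * (\<Sum>n<N. lmass n \<lbrakk>y\<rbrakk>))"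
    unfolding lmass_Suc[OF Suc.prems] by (subst sum.swap) (simp add: sum_distrib_left)
  also have "\<dots> \<le> (\<Sum>y\<in>I. height (tr x y) * 1)"
    using Suc.IH by (intro sum_mono mult_left_mono) auto
  finally show ?case using fundamental(2)[OF Suc.prems] by (simp add: deficit_def)
qed simp

definition mass :: "'a pexp \<Rightarrow> real" where "mass x = (\<Sum>n. lmass n \<lbrakk>x\<rbrakk>)"

lemma summable_lmass: "x \<in> I \<Longrightarrow> summable (\<lambda>n. lmass n \<lbrakk>x\<rbrakk>)"
  by (rule summableI_nonneg_bounded[where x = 1])
    (auto simp: sum_lmass_le lmass_nonneg prob_lang_nonneg)

lemma mass_nonneg: "x \<in> I \<Longrightarrow> 0 \<le> mass x" and mass_le_1: "x \<in> I \<Longrightarrow> mass x \<le> 1"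
  unfolding mass_def using summable_lmass[of x]
  by (auto intro!: suminf_nonneg suminf_le_const simp: sum_lmass_le lmass_nonneg prob_lang_nonneg)

lemma mass_linear: "(\<Sum>n. lmass n (\<lambda>v. \<Sum>x\<in>I. c x * \<lbrakk>x\<rbrakk> v)) = (\<Sum>x\<in>I. c x * mass x)"
  unfolding lmass_linear mass_def
  by (subst suminf_sum) (auto intro!: sum.cong summable_mult suminf_mult summable_lmass)

text \<open>This is the balance condition of \<open>linear_system\<close> for the heights
  \<open>mass\<close> when the \<open>null\<close> summands are left out.\<close>

lemma mass_eq:
  assumes "x \<in> I"
  shows "mass x = (\<Sum>y\<in>I. height (tr x y) * mass y) + \<partial> x \<checkmark>"
proof -
  have "mass x = (\<Sum>n. lmass (Suc n) \<lbrakk>x\<rbrakk>) + lmass 0 \<lbrakk>x\<rbrakk>"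
    unfolding mass_def using suminf_split_head[OF summable_lmass[OF assms]] by simp
  also have "(\<Sum>n. lmass (Suc n) \<lbrakk>x\<rbrakk>) = (\<Sum>y\<in>I. height (tr x y) * mass y)"
    unfolding lmass_Suc[OF assms] mass_linear[symmetric] lmass_linear ..
  finally show ?thesis by simp
qed

text \<open>Adding \<open>(1 - mass x)\<close> copies of \<open>null\<close> to the solution
  \<open>U\<close> of the system without \<open>null\<close> gives a solution of height 1 of the
  system in \<open>fundamental\<close>, which \<open>emb\<close> solves too.\<close>

lemma normalized:
  obtains U where "\<And>x. x \<in> I \<Longrightarrow> height (U x) = mass x"
    and "\<And>x. x \<in> I \<Longrightarrow> U x = (\<Sum>y\<in>I. tr x y * U y) + scal (\<partial> x \<checkmark>)"
    and "\<And>x. x \<in> I \<Longrightarrow> emb x = U x + scal (1 - mass x) * null"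
proof -
  have "\<exists>U. \<forall>Y. (\<forall>x\<in>I. height (Y x) = mass x \<and> Y x = (\<Sum>y\<in>I. tr x y * Y y) + scal (\<partial> x \<checkmark>))
      \<longleftrightarrow> (\<forall>x\<in>I. Y x = U x)"
    using finite_I guarded_tr mass_nonneg mass_eq
    by (intro linear_system) (simp_all add: antimirov_nonneg)
  then obtain U where U: "\<And>x. x \<in> I \<Longrightarrow> height (U x) = mass x"
    "\<And>x. x \<in> I \<Longrightarrow> U x = (\<Sum>y\<in>I. tr x y * U y) + scal (\<partial> x \<checkmark>)" by blast
  have "emb x = U x + scal (1 - mass x) * null" if "x \<in> I" for x
  proof (rule linear_system_unique[where I = I and A = tr and X = emb])
    fix x assume x: "x \<in> I"
    \<comment> \<open>Under \<open>null\<close> a coefficient counts only through its height, so the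
      correction terms form a real linear system.\<close>
    have "(\<Sum>y\<in>I. tr x y * (scal (1 - mass y) * null)) = scal (\<Sum>y\<in>I. height (tr x y) * (1 - mass y)) * null"
      (is "?l = scal ?r * null")
    proof -
      have "?l = (\<Sum>y\<in>I. scal (height (tr x y) * (1 - mass y)) * null)"
      proof (rule sum.cong)
        fix y assume "y \<in> I"
        have "tr x y * (scal (1 - mass y) * null) = scal (1 - mass y) * (tr x y * null)"
          by (rule scal_left_commute)
        also have "\<dots> = scal (1 - mass y) * (scal (height (tr x y)) * null)"
          by (subst mult_null) (rule refl)
        also have "\<dots> = scal (height (tr x y) * (1 - mass y)) * null"
          using mass_le_1[OF \<open>y \<in> I\<close>] by (simp add: mult.commute[of "height _"] scal_mult mult.assoc)
        finally show "tr x y * (scal (1 - mass y) * null) = \<dots>" .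
      qed simp
      also have "\<dots> = scal ?r * null"
        using mass_le_1 by (subst scal_sum) (auto simp: sum_distrib_right)
      finally show ?thesis .
    qed
    \<comment> \<open>The complements \<open>1 - mass\<close> satisfy the mass recursion with
      \<open>deficit x\<close> in place of the tick probability.\<close>
    moreover have "scal ?r * null + scal (deficit x) * null = scal (1 - mass x) * null"
    proof -
      have "scal ?r * null + scal (deficit x) * null = scal (?r + deficit x) * null"
        using mass_le_1 fundamental(2)[OF x] by (subst scal_add) (auto intro!: sum_nonneg simp: distrib_right)
      also have "?r + deficit x = 1 - mass x"
        using mass_eq[OF x] by (simp add: deficit_def right_diff_distrib sum_subtractf)
      finally show ?thesis .
    qed
    ultimately have "(\<Sum>y\<in>I. tr x y * (scal (1 - mass y) * null)) + scal (deficit x) * null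
      = scal (1 - mass x) * null" by simp
    moreover have "U x = (\<Sum>y\<in>I. tr x y * U y) + scal (\<partial> x \<checkmark>)" using U x by simp
    ultimately show "U x + scal (1 - mass x) * null = (\<Sum>y\<in>I. tr x y * (U y + scal (1 - mass y) * null))
        + (scal (\<partial> x \<checkmark>) + scal (deficit x) * null)"
      by (simp add: distrib_left sum.distrib add_ac)
  next
    fix x assume x: "x \<in> I"
    then show "height (emb x) = height (U x + scal (1 - mass x) * null)"
      using U(1) mass_le_1 by simp
  qed (use finite_I guarded_tr fundamental that in auto)
  then show thesis using that U by blast
qed

text \<open>Derivatives of a pair of expressions are pairs of weighted combinations, so the equality
  is proved for all language equivalent pairs of nonnegative combinations at once; \<open>e\<close>
  and \<open>f\<close> form one such pair.\<close>

lemma complete: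
  assumes "e \<in> I" "f \<in> I" "\<lbrakk>e\<rbrakk> = \<lbrakk>f\<rbrakk>"
  shows "e \<simeq> f"
proof -
  obtain U where U: "\<And>x. x \<in> I \<Longrightarrow> height (U x) = mass x"
    "\<And>x. x \<in> I \<Longrightarrow> U x = (\<Sum>y\<in>I. tr x y * U y) + scal (\<partial> x \<checkmark>)"
    "\<And>x. x \<in> I \<Longrightarrow> emb x = U x + scal (1 - mass x) * null"
    using normalized by blast
  \<comment> \<open>The boolean marks the left half (\<open>True\<close>) and the right half
    (\<open>False\<close>) of a pair of coefficient vectors.\<close>
  define J :: "('a pexp \<times> bool) set" where "J = I \<times> UNIV"
  have J: "finite J" using finite_I by (simp add: J_def)
  define lang where "lang z b v = (\<Sum>x\<in>I. z (x, b) * \<lbrakk>x\<rbrakk> v)" for z :: "'a pexp \<times> bool \<Rightarrow> real" and b v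
  define V where "V = {z. \<forall>v. lang z True v = lang z False v}"
  define Z where "Z = {z \<in> V. (\<forall>i. 0 \<le> z i) \<and> (\<forall>i. i \<notin> J \<longrightarrow> z i = 0)}"
  have Vsub: "(\<lambda>i. y i - t * z i) \<in> V" if "y \<in> V" "z \<in> V" for t y z
  proof -
    have "lang (\<lambda>i. y i - t * z i) b v = lang y b v - t * lang z b v" for b v
      by (simp add: lang_def left_diff_distrib sum_subtractf sum_distrib_left mult.assoc)
    then show ?thesis using that by (simp add: V_def)
  qed
  have "(\<lambda>_. 0) \<in> V" by (simp add: V_def lang_def)
  then have "V \<noteq> {}" by blast
  then obtain g where gZ: "\<And>S. g S \<in> Z"
    and g: "\<And>z. z \<in> Z \<Longrightarrow> \<exists>c. (\<forall>S. 0 \<le> c S) \<and> z = (\<lambda>i. \<Sum>S\<in>Pow J. c S * g S i)"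
    using cone_generators[OF J Vsub, folded Z_def] by blast
  \<comment> \<open>The derivative by \<open>a\<close> of a pair of combinations. It is set to 0 off
    \<open>I\<close> to remain supported in \<open>J\<close>.\<close>
  define D where "D a z = (\<lambda>(y, b). if y \<in> I then \<Sum>x\<in>I. z (x, b) * \<partial> x (Inr (a, y)) else 0)"
    for a and z :: "'a pexp \<times> bool \<Rightarrow> real"
  have DZ: "D a z \<in> Z" if z: "z \<in> Z" for a z
  proof -
    have "lang (D a z) b v = lang z b (a # v)" for b v
    proof -
      have "lang (D a z) b v = (\<Sum>y\<in>I. \<Sum>x\<in>I. z (x, b) * (\<partial> x (Inr (a, y)) * \<lbrakk>y\<rbrakk> v))"
        by (simp add: lang_def D_def sum_distrib_right mult.assoc)
      also have "\<dots> = lang z b (a # v)"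
        unfolding lang_def
        by (subst sum.swap) (simp add: prob_lang_Cons sum_distrib_left del: prob_lang.simps)
      finally show ?thesis .
    qed
    then show ?thesis using z
      by (auto simp: Z_def V_def D_def J_def antimirov_nonneg intro!: sum_nonneg)
  qed
  \<comment> \<open>With \<open>U\<close> in place of \<open>emb\<close>, the height of a
    combination is the total mass of its language. The height of a combination of the
    \<open>emb x\<close> would be the sum of its coefficients, which the language does not
    determine.\<close>
  define \<xi> where "\<xi> z b = (\<Sum>x\<in>I. scal (z (x, b)) * U x)" for z :: "'a pexp \<times> bool \<Rightarrow> real" and b
  have \<xi>_height: "height (\<xi> z b) = (\<Sum>n. lmass n (lang z b))" if "z \<in> Z" for z b
    unfolding lang_def[abs_def] mass_linear using that U(1) by (simp add: \<xi>_def Z_def)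
  have \<xi>_step: "\<xi> z b = (\<Sum>a\<in>UNIV. emb (Atom a) * \<xi> (D a z) b) + scal (lang z b [])"
    if z: "z \<in> Z" for z b
  proof -
    have z0: "0 \<le> z i" for i using z unfolding Z_def by blast
    have "\<xi> z b = (\<Sum>x\<in>I. scal (z (x, b)) * ((\<Sum>y\<in>I. tr x y * U y) + scal (\<partial> x \<checkmark>)))"
      unfolding \<xi>_def using U(2) by (intro sum.cong) auto
    also have "\<dots> = (\<Sum>x\<in>I. \<Sum>y\<in>I. \<Sum>a\<in>UNIV. scal (z (x, b)) * (scal (\<partial> x (Inr (a, y))) * (emb (Atom a) * U y)))
        + (\<Sum>x\<in>I. scal (z (x, b)) * scal (\<partial> x \<checkmark>))"
      by (simp add: tr_def distrib_left sum.distrib sum_distrib_left sum_distrib_right mult.assoc)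
    also have "(\<Sum>x\<in>I. scal (z (x, b)) * scal (\<partial> x \<checkmark>)) = scal (lang z b [])"
      using z0 by (simp add: lang_def scal_sum scal_mult antimirov_nonneg)
    also have "(\<Sum>x\<in>I. \<Sum>y\<in>I. \<Sum>a\<in>UNIV. scal (z (x, b)) * (scal (\<partial> x (Inr (a, y))) * (emb (Atom a) * U y)))
        = (\<Sum>a\<in>UNIV. \<Sum>y\<in>I. \<Sum>x\<in>I. scal (z (x, b) * \<partial> x (Inr (a, y))) * (emb (Atom a) * U y))"
      using z0 by (subst sum.swap, subst (2) sum.swap, subst sum.swap) (simp add: scal_mult mult.assoc)
    also have "\<dots> = (\<Sum>a\<in>UNIV. \<Sum>y\<in>I. scal (D a z (y, b)) * (emb (Atom a) * U y))"
      using z0 by (simp add: D_def scal_sum antimirov_nonneg sum_distrib_right)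
    also have "\<dots> = (\<Sum>a\<in>UNIV. emb (Atom a) * \<xi> (D a z) b)"
      by (simp add: \<xi>_def sum_distrib_left scal_left_commute[of "emb _"])
    finally show ?thesis .
  qed
  have \<xi>_sum: "\<xi> (\<lambda>i. \<Sum>S\<in>Pow J. c S * g S i) b = (\<Sum>S\<in>Pow J. scal (c S) * \<xi> (g S) b)"
    if c: "\<forall>S. 0 \<le> c S" for c b
  proof -
    have g0: "0 \<le> g S i" for S i using gZ[of S] unfolding Z_def by blast
    have "\<xi> (\<lambda>i. \<Sum>S\<in>Pow J. c S * g S i) b = (\<Sum>x\<in>I. \<Sum>S\<in>Pow J. scal (c S) * (scal (g S (x, b)) * U x))"
      using g0 c by (simp add: \<xi>_def scal_sum scal_mult sum_distrib_right mult.assoc)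
    also have "\<dots> = (\<Sum>S\<in>Pow J. scal (c S) * \<xi> (g S) b)"
      by (subst sum.swap) (simp add: \<xi>_def sum_distrib_left)
    finally show ?thesis .
  qed
  \<comment> \<open>The derivatives of a generator lie in the cone again, so they are nonnegative
    combinations of the finitely many generators and the system closes up.\<close>
  have "\<forall>S a. \<exists>c. (\<forall>T. 0 \<le> c T) \<and> D a (g S) = (\<lambda>i. \<Sum>T\<in>Pow J. c T * g T i)"
    using g[OF DZ[OF gZ]] by blast
  then obtain c where c: "\<And>S a T. 0 \<le> c S a T"
    and Dg: "\<And>S a. D a (g S) = (\<lambda>i. \<Sum>T\<in>Pow J. c S a T * g T i)"
    by metis
  \<comment> \<open>The coefficients do not mention the boolean: one system governs both halves, and
    \<open>lang_eq\<close> makes its constant terms and heights agree as well.\<close>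
  define A :: "_ \<Rightarrow> _ \<Rightarrow> 'a wexp" where "A S T = (\<Sum>a\<in>UNIV. scal (c S a T) * emb (Atom a))" for S T
  have \<xi>_sys: "\<xi> (g S) b = (\<Sum>T\<in>Pow J. A S T * \<xi> (g T) b) + scal (lang (g S) b [])" for S b
  proof -
    have "(\<Sum>a\<in>UNIV. emb (Atom a) * \<xi> (D a (g S)) b)
        = (\<Sum>a\<in>UNIV. \<Sum>T\<in>Pow J. scal (c S a T) * (emb (Atom a) * \<xi> (g T) b))"
      unfolding Dg using c by (simp add: \<xi>_sum sum_distrib_left scal_left_commute[of "emb _"])
    also have "\<dots> = (\<Sum>T\<in>Pow J. A S T * \<xi> (g T) b)"
      by (subst sum.swap) (simp add: A_def sum_distrib_right mult.assoc)
    finally show ?thesis using \<xi>_step[OF gZ, of S b] by simp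
  qed
  have lang_eq: "lang z True = lang z False" if "z \<in> Z" for z
    using that by (auto simp: Z_def V_def)
  have \<xi>_g: "\<xi> (g S) True = \<xi> (g S) False" if "S \<in> Pow J" for S
  proof (rule linear_system_unique[where I = "Pow J" and A = A])
    show "guarded (A S T)" for S T
      unfolding A_def by (intro guarded_sum guarded_mult disjI2 guarded_emb) simp
    show "height (\<xi> (g S) True) = height (\<xi> (g S) False)" for S
      using \<xi>_height[OF gZ] lang_eq[OF gZ] by simp
    show "\<xi> (g S) True = (\<Sum>T\<in>Pow J. A S T * \<xi> (g T) True) + scal (lang (g S) True [])" for S
      by (rule \<xi>_sys)
    show "\<xi> (g S) False = (\<Sum>T\<in>Pow J. A S T * \<xi> (g T) False) + scal (lang (g S) True [])" for S
      unfolding lang_eq[OF gZ] by (rule \<xi>_sys)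
  qed (use J that in auto)
  \<comment> \<open>The pair consisting of the unit vectors at \<open>e\<close> and at
    \<open>f\<close>.\<close>
  define z where "z = (\<lambda>(x, b). if x = (if b then e else f) then 1 else 0 :: real)"
  have "lang z b = \<lbrakk>if b then e else f\<rbrakk>" for b
    using assms finite_I by (auto simp: lang_def z_def fun_eq_iff if_distrib[of "\<lambda>r. r * _"] cong: if_cong)
  then have zZ: "z \<in> Z"
    using assms by (auto simp: Z_def V_def J_def z_def split: if_splits)
  have \<xi>z: "\<xi> z b = U (if b then e else f)" for b
    using assms finite_I by (auto simp: \<xi>_def z_def if_distrib[of scal] if_distrib[of "\<lambda>r. r * _"] cong: if_cong)
  obtain d where d: "\<forall>S. 0 \<le> d S" "z = (\<lambda>i. \<Sum>S\<in>Pow J. d S * g S i)"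
    using g[OF zZ] by blast
  have "\<xi> z True = \<xi> z False"
    unfolding d(2) \<xi>_sum[OF d(1)] using \<xi>_g by (intro sum.cong) auto
  then have "U e = U f" using \<xi>z[of True] \<xi>z[of False] by simp
  moreover have "mass e = mass f" using assms by (simp add: mass_def)
  ultimately have "emb e = emb f" using U(3) assms by simp
  then show ?thesis by (simp add: emb_eq_iff)
qed

end

theorem theorem7p12:
  fixes e f :: "('a::finite) pexp"
  assumes "\<lbrakk>e\<rbrakk> = \<lbrakk>f\<rbrakk>"
  shows "e \<simeq> f"
proof -
  \<comment> \<open>Joining the two closures places both expressions in one finite system.\<close>
  interpret derivative_closed "derivs e \<union> derivs f"
    by unfold_locales (auto simp: finite_derivs intro: derivs_closed)
  show ?thesis using complete assms by (auto simp: self_derivs)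
qed

end
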